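(* $\mathsf{OG\mapsto\alpha}\not\leq_{\mathsf{W}}\mathsf{C}_{\mathbb{N}^{\mathbb{N}}}$, where $\mathsf{OG\mapsto\alpha}$ is the problem which, given a countable ordered group $(G,\leq)$, outputs a copy of the well-order $\alpha$ such that the order type of $G$ is $\mathbb{Z}^{\alpha}\mathbb{Q}^{\epsilon}$ for some $\epsilon\in\{0,1\}$.
   Context: Weihrauch reducibility: a represented space is a set $X$ with a partial surjection $\delta_X:\subseteq\mathbb{N}^{\mathbb{N}}\to X$; if $\delta_X(p)=x$, $p$ is a name of $x$. A problem is a partial multi-valued function between represented spaces. $f\leq_{\mathsf{W}}g$ iff there are computable partial functions $\Phi,\Psi$ on Baire space such that whenever $p$ is a name of some $x\in\mathrm{dom}(f)$, $\Phi(p)$ is a name of some $z\in\mathrm{dom}(g)$, and for every name $q$ of an element of $g(z)$, $\Psi(p,q)$ is a name of an element of $f(x)$. Ordered groups: an ordered group is a group $G$ with a linear order $\leq$ such that $a\leq b$ implies $ag\leq bg$ and $ga\leq gb$ for all $g$. Countable ordered groups are presented on subsets of $\mathbb{N}$, a name coding the universe, operation and order. The order type of $G$ is a linear order $X$ such that there is an order-preserving bijection $G\to X$. For linear orders $X,Y$, the product $XY$ is $X\times Y$ with $\langle x_0,y_0\rangle<\langle x_1,y_1\rangle$ iff $y_0<y_1$, or $y_0=y_1$ and $x_0<x_1$. $\mathbb{Z}^X$ is the set of finitely supported functions $X\to\mathbb{Z}$, where for $f\neq g$, $f<g$ iff $f(x)<g(x)$ at the maximum $x$ where they differ. $\mathbb{Z}^\alpha\mathbb{Q}^0=\mathbb{Z}^\alpha$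 and $\mathbb{Z}^\alpha\mathbb{Q}^1=\mathbb{Z}^\alpha\mathbb{Q}$. By Maltsev's theorem every countable ordered group has order type $\mathbb{Z}^\alpha\mathbb{Q}^\epsilon$ for some ordinal $\alpha$ and $\epsilon\in\{0,1\}$. A copy of an ordinal $\alpha$ is a pair $(A,<_A)$ with $A\subseteq\mathbb{N}$, $<_A\subseteq A\times A$ a well-order of $A$ isomorphic to $\alpha$, coded in Baire space. $\mathsf{C}_{\mathbb{N}^{\mathbb{N}}}$ (closed choice on Baire space) is, up to Weihrauch equivalence, the problem: given an ill-founded tree $T\subseteq\mathbb{N}^{<\mathbb{N}}$, output an infinite path through $T$. *)

theory Defs
  imports
    Complex_Main
    "HOL-Library.Nat_Bijection"
    "HOL-Library.Sublist"
    "HOL-Algebra.Group"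
begin

section \<open>Computable partial functions on Baire space\<close>

type_synonym baire = "nat \<Rightarrow> nat"

text \<open>
  Kleene's \<open>\<mu>\<close>-recursive functions with a constructor for queries to an oracle \<open>p\<close>, given by
  codes and a big-step semantics: \<open>oeval p c xs v\<close> means that program \<open>c\<close> with oracle \<open>p\<close>
  halts on the arguments \<open>xs\<close> with value \<open>v\<close>.
\<close>

datatype oprog =
    Zer
  | Succ
  | Proj nat
  | Oracle
  | Comp oprog "oprog list"
  | PRec oprog oprog
  | Min oprog

inductive oeval :: "baire \<Rightarrow> oprog \<Rightarrow> nat list \<Rightarrow> nat \<Rightarrow> bool" for p :: baire where
  zer: "oeval p Zer xs 0"
| succ: "oeval p Succ [x] (Suc x)"
| proj: "i < length xs \<Longrightarrow> oeval p (Proj i) xs (xs ! i)"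
| orac: "oeval p Oracle [x] (p x)"
| comp: "list_all2 (\<lambda>g y. oeval p g xs y) gs ys \<Longrightarrow> oeval p f ys v \<Longrightarrow> oeval p (Comp f gs) xs v"
| prec_0: "oeval p f xs v \<Longrightarrow> oeval p (PRec f g) (0 # xs) v"
| prec_Suc: "oeval p (PRec f g) (n # xs) u \<Longrightarrow> oeval p g (n # u # xs) v
    \<Longrightarrow> oeval p (PRec f g) (Suc n # xs) v"
| min: "oeval p f (n # xs) 0 \<Longrightarrow> (\<forall>m<n. \<exists>k. oeval p f (m # xs) (Suc k))
    \<Longrightarrow> oeval p (Min f) xs n"

lemma oeval_det: "oeval p c xs v \<Longrightarrow> oeval p c xs w \<Longrightarrow> w = v"
proof (induction arbitrary: w rule: oeval.induct)
  case (comp xs gs ys f v)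
  from comp.prems obtain zs where
    zs: "list_all2 (\<lambda>g y. oeval p g xs y) gs zs" and w: "oeval p f zs w"
    by cases auto
  have "zs = ys"
    using comp.IH(1) zs by (auto simp: list_all2_conv_all_nth intro!: nth_equalityI)
  then show ?case using comp.IH(2) w by blast
next
  case (prec_0 f xs v g)
  from prec_0.prems have "oeval p f xs w" by cases auto
  then show ?case by (rule prec_0.IH)
next
  case (prec_Suc f g n xs u v)
  from prec_Suc.prems obtain u' where
    "oeval p (PRec f g) (n # xs) u'" "oeval p g (n # u' # xs) w"
    by cases auto
  then show ?case using prec_Suc.IH by blast
next
  case (min f n xs)
  from min.prems have 0: "oeval p f (w # xs) 0"
    and less: "\<forall>m<w. \<exists>k. oeval p f (m # xs) (Suc k)"
    by (cases, auto)+
  have "\<not> n < w" using less min.IH(1) by fastforce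
  moreover have "\<not> w < n" using 0 min.IH(2) by fastforce
  ultimately show ?case by simp
qed (erule oeval.cases; simp)+

text \<open>As usual for partial functions on Baire space, the program may also converge outside the
  domain of the function.\<close>

definition computable :: "(baire \<rightharpoonup> baire) \<Rightarrow> bool" where
  "computable F \<longleftrightarrow> (\<exists>c. \<forall>p q. F p = Some q \<longrightarrow> (\<forall>n. oeval p c [n] (q n)))"

definition baire_pair :: "baire \<Rightarrow> baire \<Rightarrow> baire" where
  "baire_pair p q n = (if even n then p (n div 2) else q (n div 2))"


section \<open>Represented spaces, problems and Weihrauch reducibility\<close>

text \<open>A represented space is given by its representation; the underlying set is its range,
  so the representation is onto by construction.\<close>

type_synonym 'a repr = "baire \<rightharpoonup> 'a"

abbreviation rspace :: "'a repr \<Rightarrow> 'a set" where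
  "rspace \<delta> \<equiv> ran \<delta>"

text \<open>The domain of a problem consists of the instances with at least one solution.\<close>

record ('a, 'b) problem =
  in_rep :: "'a repr"
  out_rep :: "'b repr"
  sol :: "'a \<Rightarrow> 'b set"

definition pdom :: "('a, 'b) problem \<Rightarrow> 'a set" where
  "pdom f = {x. sol f x \<noteq> {}}"

definition is_problem :: "('a, 'b) problem \<Rightarrow> bool" where
  "is_problem f \<longleftrightarrow> pdom f \<subseteq> rspace (in_rep f) \<and> (\<forall>x. sol f x \<subseteq> rspace (out_rep f))"

definition is_name :: "'a repr \<Rightarrow> baire \<Rightarrow> 'a \<Rightarrow> bool" where
  "is_name \<delta> p x \<longleftrightarrow> \<delta> p = Some x"

definition weihrauch_le :: "('a, 'b) problem \<Rightarrow> ('c, 'd) problem \<Rightarrow> bool"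
    (infix \<open>\<le>\<^sub>W\<close> 50) where
  "f \<le>\<^sub>W g \<longleftrightarrow>
    (\<exists>\<Phi> \<Psi>. computable \<Phi> \<and> computable \<Psi> \<and>
      (\<forall>p. \<forall>x\<in>pdom f. is_name (in_rep f) p x \<longrightarrow>
        (\<exists>p'. \<Phi> p = Some p' \<and>
          (\<exists>z\<in>pdom g. is_name (in_rep g) p' z \<and>
            (\<forall>q. \<forall>w\<in>sol g z. is_name (out_rep g) q w \<longrightarrow>
              (\<exists>q'. \<Psi> (baire_pair p q) = Some q' \<and>
                (\<exists>y\<in>sol f x. is_name (out_rep f) q' y)))))))"


section \<open>Closed choice on Baire space\<close>

definition is_tree :: "nat list set \<Rightarrow> bool" where
  "is_tree T \<longleftrightarrow> (\<forall>\<sigma>\<in>T. \<forall>\<tau>. prefix \<tau> \<sigma> \<longrightarrow> \<tau> \<in> T)"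

definition is_path :: "nat list set \<Rightarrow> baire \<Rightarrow> bool" where
  "is_path T f \<longleftrightarrow> (\<forall>n. map f [0..<n] \<in> T)"

definition tree_rep :: "nat list set repr" where
  "tree_rep p = (let T = {\<sigma>. p (list_encode \<sigma>) = 1} in if is_tree T then Some T else None)"

definition closed_choice_baire :: "(nat list set, baire) problem" (\<open>C\<^sub>N\<^sub>N\<close>) where
  "C\<^sub>N\<^sub>N = \<lparr>in_rep = tree_rep, out_rep = Some, sol = (\<lambda>T. {f. is_tree T \<and> is_path T f})\<rparr>"


section \<open>Linear orders\<close>

text \<open>A linear order is a reflexive relation whose universe is its \<^const>\<open>Field\<close>.\<close>

definition order_isomorphic :: "'a rel \<Rightarrow> 'b rel \<Rightarrow> bool" where
  "order_isomorphic r s \<longleftrightarrow>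
    (\<exists>h. bij_betw h (Field r) (Field s) \<and>
      (\<forall>x\<in>Field r. \<forall>y\<in>Field r. (x, y) \<in> r \<longleftrightarrow> (h x, h y) \<in> s))"

definition rat_order :: "rat rel" where
  "rat_order = {(a, b). a \<le> b}"

text \<open>The product \<open>r s\<close>, in which the second coordinate is the more significant one.\<close>

definition order_prod :: "'a rel \<Rightarrow> 'b rel \<Rightarrow> ('a \<times> 'b) rel" where
  "order_prod r s =
    {((x0, y0), (x1, y1)).
      x0 \<in> Field r \<and> x1 \<in> Field r \<and> y0 \<in> Field s \<and> y1 \<in> Field s \<and>
      ((y0 \<noteq> y1 \<and> (y0, y1) \<in> s) \<or> (y0 = y1 \<and> (x0, x1) \<in> r))}"

text \<open>Finitely supported functions on the universe of \<open>r\<close>, extended by \<open>0\<close> to the whole type.\<close>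

definition fin_supp :: "'a rel \<Rightarrow> ('a \<Rightarrow> int) set" where
  "fin_supp r = {f. finite {x. f x \<noteq> 0} \<and> {x. f x \<noteq> 0} \<subseteq> Field r}"

text \<open>Below, \<open>x\<close> is the \<open>r\<close>-maximum of the points where \<open>f\<close> and \<open>g\<close> differ.\<close>

definition Z_pow :: "'a rel \<Rightarrow> ('a \<Rightarrow> int) rel" where
  "Z_pow r =
    {(f, g). f \<in> fin_supp r \<and> g \<in> fin_supp r \<and>
      (f = g \<or> (\<exists>x. f x < g x \<and> (\<forall>y. f y \<noteq> g y \<longrightarrow> (y, x) \<in> r)))}"

text \<open>\<open>has_type_ZQ r \<alpha> \<epsilon>\<close>: the order type of \<open>r\<close> is \<open>\<int>\<^sup>\<alpha> \<rat>\<^sup>\<epsilon>\<close>.\<close>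

definition has_type_ZQ :: "'a rel \<Rightarrow> 'b rel \<Rightarrow> nat \<Rightarrow> bool" where
  "has_type_ZQ r \<alpha> \<epsilon> \<longleftrightarrow>
    (if \<epsilon> = 0 then order_isomorphic r (Z_pow \<alpha>)
     else order_isomorphic r (order_prod (Z_pow \<alpha>) rat_order))"


section \<open>Countable ordered groups\<close>

definition ordered_group :: "('a, 'm) monoid_scheme \<Rightarrow> 'a rel \<Rightarrow> bool" where
  "ordered_group G R \<longleftrightarrow>
    group G \<and> linear_order_on (carrier G) R \<and>
    (\<forall>a\<in>carrier G. \<forall>b\<in>carrier G. \<forall>g\<in>carrier G. (a, b) \<in> R \<longrightarrow>
      (a \<otimes>\<^bsub>G\<^esub> g, b \<otimes>\<^bsub>G\<^esub> g) \<in> R \<and> (g \<otimes>\<^bsub>G\<^esub> a, g \<otimes>\<^bsub>G\<^esub> b) \<in> R)"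

text \<open>
  The three sections of \<open>p\<close> code the universe (where the value 1 means membership), the operation
  and the order. The operation is set to 0 outside the universe, so that each presented group is a
  unique record; the neutral element is determined by the operation and is not part of the name.
\<close>

definition group_of :: "baire \<Rightarrow> nat monoid" where
  "group_of p =
    (let A = {n. p (prod_encode (0, n)) = 1};
         m = (\<lambda>x y. if x \<in> A \<and> y \<in> A then p (prod_encode (1, prod_encode (x, y))) else 0)
     in \<lparr>carrier = A, mult = m, one = (THE e. e \<in> A \<and> (\<forall>x\<in>A. m e x = x \<and> m x e = x))\<rparr>)"

definition order_of :: "baire \<Rightarrow> nat rel" where
  "order_of p = {(x, y). p (prod_encode (2, prod_encode (x, y))) = 1}"

definition og_rep :: "(nat monoid \<times> nat rel) repr" where
  "og_rep p =
    (if ordered_group (group_of p) (order_of p) then Some (group_of p, order_of p) else None)"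


section \<open>Copies of ordinals\<close>

definition strict_well_order_on :: "nat set \<Rightarrow> nat rel \<Rightarrow> bool" where
  "strict_well_order_on A lt \<longleftrightarrow> lt \<subseteq> A \<times> A \<and> irrefl lt \<and> well_order_on A (lt \<union> Id_on A)"

definition is_copy :: "nat set \<times> nat rel \<Rightarrow> 'a rel \<Rightarrow> bool" where
  "is_copy = (\<lambda>(A, lt) \<alpha>. strict_well_order_on A lt \<and> order_isomorphic (lt \<union> Id_on A) \<alpha>)"

definition copy_rep :: "(nat set \<times> nat rel) repr" where
  "copy_rep p =
    (let A = {n. p (prod_encode (0, n)) = 1};
         lt = {(x, y). p (prod_encode (1, prod_encode (x, y))) = 1}
     in if strict_well_order_on A lt then Some (A, lt) else None)"

text \<open>The ordinal \<open>\<alpha>\<close> is taken as a well-order on a set of natural numbers; having a copy, it is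
  countable, so no ordinal is lost.\<close>

definition OG_to_ordinal :: "(nat monoid \<times> nat rel, nat set \<times> nat rel) problem" where
  "OG_to_ordinal =
    \<lparr>in_rep = og_rep, out_rep = copy_rep,
     sol = (\<lambda>(G, R). {B. (G, R) \<in> rspace og_rep \<and>
       (\<exists>\<alpha> :: nat rel. \<exists>\<epsilon>\<in>{0, 1}. Well_order \<alpha> \<and> has_type_ZQ R \<alpha> \<epsilon> \<and> is_copy B \<alpha>)})\<rparr>"


section \<open>Well-formedness\<close>

lemma copy_rep_onto:
  assumes "strict_well_order_on A lt"
  shows "(A, lt) \<in> rspace copy_rep"
proof -
  define p :: baire where "p n = (case prod_decode n of (i, k) \<Rightarrow>
    if i = 0 then of_bool (k \<in> A) else of_bool (prod_decode k \<in> lt))" for n :: nat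
  have "copy_rep p = Some (A, lt)"
    using assms by (simp add: copy_rep_def p_def)
  then show ?thesis by (auto simp: ran_def)
qed

lemma og_rep_onto:
  fixes G :: "nat monoid"
  assumes og: "ordered_group G R"
    and 0: "\<And>x y. \<not> (x \<in> carrier G \<and> y \<in> carrier G) \<Longrightarrow> x \<otimes>\<^bsub>G\<^esub> y = 0"
  shows "(G, R) \<in> rspace og_rep"
proof -
  interpret group G using og by (simp add: ordered_group_def)
  define p where "p n = (case prod_decode n of (i, k) \<Rightarrow>
    if i = 0 then of_bool (k \<in> carrier G)
    else if i = 1 then case_prod (mult G) (prod_decode k)
    else of_bool (prod_decode k \<in> R))" for n :: nat
  have e: "(THE e. e \<in> carrier G \<and> (\<forall>x\<in>carrier G. e \<otimes>\<^bsub>G\<^esub> x = x \<and> x \<otimes>\<^bsub>G\<^esub> e = x)) = \<one>\<^bsub>G\<^esub>"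
    by (rule the_equality) (use r_one in \<open>fastforce+\<close>)
  have A: "{n. p (prod_encode (0, n)) = 1} = carrier G"
    by (simp add: p_def)
  have op: "p (prod_encode (1, prod_encode (x, y))) = x \<otimes>\<^bsub>G\<^esub> y" for x y
    by (simp add: p_def)
  have mG: "(if x \<in> carrier G \<and> y \<in> carrier G then x \<otimes>\<^bsub>G\<^esub> y else 0) = x \<otimes>\<^bsub>G\<^esub> y" for x y
    using 0 by auto
  have "group_of p = G"
    unfolding group_of_def Let_def A op mG e by simp
  moreover have "order_of p = R"
    by (simp add: order_of_def p_def)
  ultimately have "og_rep p = Some (G, R)"
    using og by (simp add: og_rep_def)
  then show ?thesis by (auto simp: ran_def)
qed

lemma is_problem_OG_to_ordinal: "is_problem OG_to_ordinal"
  by (auto simp: is_problem_def pdom_def OG_to_ordinal_def is_copy_def intro: copy_rep_onto)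

lemma is_problem_closed_choice_baire: "is_problem closed_choice_baire"
proof -
  have "T \<in> rspace tree_rep" if "is_tree T" for T
  proof -
    have "tree_rep (\<lambda>n. of_bool (list_decode n \<in> T)) = Some T"
      using that by (simp add: tree_rep_def)
    then show ?thesis by (auto simp: ran_def)
  qed
  then show ?thesis
    by (auto simp: is_problem_def pdom_def closed_choice_baire_def ran_def)
qed

end

(*
  Suppose that the reduction exists. For a linear order L on the natural numbers, the group Z^L has
  order type Z^W Q^eps, where W is the well-founded part of L (Cantor's theorem handles the rest of
  L), and if L is a well-order, then every solution for Z^L is an ordinal into which L embeds. Hence
  L is a well-order iff there are a path q through the tree computed from Z^L and an embedding of L
  into the relation computed from Z^L and q: if L is ill-founded, that relation is a well-order and
  admits no such embedding. Computable functions are continuous, so this would make the set of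
  well-orders analytic. Kleene-Brouwer orders and diagonalisation against a universal closed
  relation refute this.
*)

theory Submission
  imports Defs "HOL-Library.Countable_Set"
begin


section \<open>Powers of the integers and products of linear orders\<close>

text \<open>What needs an argument is that Z^r remembers r. Only r \<le> \<alpha> is extracted from
  an isomorphism of Z^r with Z^\<alpha> Q^\<epsilon>. The invariant is the hierarchy of iterated
  finite condensations, in which every element of the exponent accounts for one collapse of copies
  of Z; a dense or one-point remainder ends it.

  The domain of a problem consists of the instances with a solution. So the order type of Z^L has to
  be computed for ill-founded L as well; otherwise the reduction would promise nothing there.

  Membership in the computed tree and in the computed relation is the outcome of a halting
  computation, thus an open condition on the oracle. A bound on the oracle use, stored in the
  witness, makes it clopen, and countably many clopen conditions define a closed relation. A point x
  codes a closed relation by marking initial segments. One x is chosen to code the relation "f is a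
  witness for L x", where L x is the Kleene-Brouwer order of the section at x of the relation that x
  codes.\<close>

lemma Linear_order_cases:
  assumes "Linear_order r" "x \<in> Field r" "y \<in> Field r"
  obtains "(x, y) \<in> r" | "(y, x) \<in> r"
  using assms unfolding order_on_defs refl_on_def total_on_def by metis

lemma order_isomorphicE:
  assumes "order_isomorphic r s"
  obtains h where "bij_betw h (Field r) (Field s)"
    "\<And>x y. x \<in> Field r \<Longrightarrow> y \<in> Field r \<Longrightarrow> (h x, h y) \<in> s \<longleftrightarrow> (x, y) \<in> r"
  using assms unfolding order_isomorphic_def by blast

lemma order_isomorphicI:
  assumes h: "bij_betw h (Field r) (Field s)" and r: "Linear_order r" and s: "antisym s"
    and mono: "\<And>x y. (x, y) \<in> r \<Longrightarrow> (h x, h y) \<in> s"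
  shows "order_isomorphic r s"
  unfolding order_isomorphic_def
proof (intro exI[of _ h] conjI ballI iffI h)
  fix x y
  assume xy: "x \<in> Field r" "y \<in> Field r" and le: "(h x, h y) \<in> s"
  show "(x, y) \<in> r"
  proof (rule ccontr)
    assume n: "(x, y) \<notin> r"
    with xy r have "(y, x) \<in> r" by (auto elim: Linear_order_cases)
    with mono le s have "h x = h y" by (auto simp: antisym_def)
    with h xy have "x = y" by (auto simp: bij_betw_def inj_on_def)
    with n xy r show False by (auto simp: order_on_defs refl_on_def)
  qed
qed (rule mono)

lemma order_isomorphic_refl: "order_isomorphic r r"
  unfolding order_isomorphic_def by (intro exI[of _ id]) auto

lemma order_isomorphic_sym:
  assumes "order_isomorphic r s"
  shows "order_isomorphic s r"
  using assms
proof (rule order_isomorphicE)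
  fix h
  assume h: "bij_betw h (Field r) (Field s)"
    and iff: "\<And>x y. x \<in> Field r \<Longrightarrow> y \<in> Field r \<Longrightarrow> (h x, h y) \<in> s \<longleftrightarrow> (x, y) \<in> r"
  let ?g = "inv_into (Field r) h"
  have "(x, y) \<in> s \<longleftrightarrow> (?g x, ?g y) \<in> r" if "x \<in> Field s" "y \<in> Field s" for x y
  proof -
    from h that have "x \<in> h ` Field r" "y \<in> h ` Field r" by (simp_all add: bij_betw_def)
    then show ?thesis
      using iff[of "?g x" "?g y"] by (simp add: f_inv_into_f inv_into_into)
  qed
  with bij_betw_inv_into[OF h] show ?thesis
    unfolding order_isomorphic_def by blast
qed

lemma order_isomorphic_trans:
  assumes "order_isomorphic r s" "order_isomorphic s t"
  shows "order_isomorphic r t"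
proof -
  from assms(1) obtain h where h: "bij_betw h (Field r) (Field s)"
    "\<And>x y. x \<in> Field r \<Longrightarrow> y \<in> Field r \<Longrightarrow> (h x, h y) \<in> s \<longleftrightarrow> (x, y) \<in> r"
    by (rule order_isomorphicE) blast
  from assms(2) obtain g where g: "bij_betw g (Field s) (Field t)"
    "\<And>x y. x \<in> Field s \<Longrightarrow> y \<in> Field s \<Longrightarrow> (g x, g y) \<in> t \<longleftrightarrow> (x, y) \<in> s"
    by (rule order_isomorphicE) blast
  have "h x \<in> Field s" if "x \<in> Field r" for x
    using h(1) that by (auto simp: bij_betw_def)
  then show ?thesis
    unfolding order_isomorphic_def
    using bij_betw_trans[OF h(1) g(1)] h(2) g(2) by (intro exI[of _ "g \<circ> h"]) auto
qed

lemma order_isomorphic_cong_left: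
  "order_isomorphic r s \<Longrightarrow> order_isomorphic r t \<longleftrightarrow> order_isomorphic s t"
  using order_isomorphic_trans order_isomorphic_sym by metis

lemma order_prod_iff:
  "((a, b), (c, d)) \<in> order_prod r s \<longleftrightarrow> a \<in> Field r \<and> c \<in> Field r \<and> b \<in> Field s \<and> d \<in> Field s \<and>
    (b \<noteq> d \<and> (b, d) \<in> s \<or> b = d \<and> (a, c) \<in> r)"
  by (simp add: order_prod_def)

lemma Field_order_prod:
  assumes "Refl r" "Refl s"
  shows "Field (order_prod r s) = Field r \<times> Field s"
proof -
  have "(a, a) \<in> order_prod r s" if "a \<in> Field r \<times> Field s" for a
    using that assms by (auto simp: order_prod_def refl_on_def)
  then have "Field r \<times> Field s \<subseteq> Field (order_prod r s)" unfolding Field_def[of "order_prod r s"] by blast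
  moreover have "Field (order_prod r s) \<subseteq> Field r \<times> Field s"
    unfolding Field_def[of "order_prod r s"] by (auto simp: order_prod_def)
  ultimately show ?thesis by blast
qed

lemma Linear_order_order_prod:
  assumes r: "Linear_order r" and s: "Linear_order s"
  shows "Linear_order (order_prod r s)"
proof -
  have F: "Field (order_prod r s) = Field r \<times> Field s"
    using assms by (simp add: Field_order_prod order_on_defs)
  have r': "refl_on (Field r) r" "trans r" "antisym r" "total_on (Field r) r"
    and s': "refl_on (Field s) s" "trans s" "antisym s" "total_on (Field s) s"
    using assms by (simp_all add: order_on_defs)
  have "refl_on (Field r \<times> Field s) (order_prod r s)"
    using r'(1) by (auto simp: order_prod_def refl_on_def)
  moreover have "order_prod r s \<subseteq> (Field r \<times> Field s) \<times> (Field r \<times> Field s)"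
    by (auto simp: order_prod_def)
  moreover have "trans (order_prod r s)"
    using r'(2) s'(2,3) unfolding order_prod_def trans_def antisym_def by blast
  moreover have "antisym (order_prod r s)"
    using r'(3) s'(3) unfolding order_prod_def antisym_def by blast
  moreover have "total_on (Field r \<times> Field s) (order_prod r s)"
    using r'(4) s'(4) unfolding order_prod_def total_on_def by auto
  ultimately show ?thesis unfolding order_on_defs F by blast
qed

lemma order_prod_cong:
  assumes s: "order_isomorphic s s'" and refl: "Refl r" "Refl s" "Refl s'"
  shows "order_isomorphic (order_prod r s) (order_prod r s')"
proof -
  from s obtain h where h: "bij_betw h (Field s) (Field s')"
    "\<And>x y. x \<in> Field s \<Longrightarrow> y \<in> Field s \<Longrightarrow> (h x, h y) \<in> s' \<longleftrightarrow> (x, y) \<in> s"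
    by (rule order_isomorphicE) blast
  have inj: "h x = h y \<longleftrightarrow> x = y" if "x \<in> Field s" "y \<in> Field s" for x y
    using h(1) that by (auto simp: bij_betw_def inj_on_def)
  have im: "h x \<in> Field s'" if "x \<in> Field s" for x
    using h(1) that by (auto simp: bij_betw_def)
  have "h ` Field s = Field s'" using h(1) by (simp add: bij_betw_def)
  then have "bij_betw (\<lambda>(a, b). (a, h b)) (Field r \<times> Field s) (Field r \<times> Field s')"
    by (force simp: bij_betw_def inj_on_def inj)
  then show ?thesis
    unfolding order_isomorphic_def Field_order_prod[OF refl(1,2)] Field_order_prod[OF refl(1,3)]
  proof (intro exI[of _ "\<lambda>(a, b). (a, h b)"] conjI ballI)
    fix u v assume "u \<in> Field r \<times> Field s" "v \<in> Field r \<times> Field s"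
    then obtain a b c d where "u = (a, b)" "v = (c, d)"
      "a \<in> Field r" "b \<in> Field s" "c \<in> Field r" "d \<in> Field s" by blast
    then show "(u, v) \<in> order_prod r s \<longleftrightarrow>
        ((case u of (a, b) \<Rightarrow> (a, h b)), (case v of (a, b) \<Rightarrow> (a, h b))) \<in> order_prod r s'"
      using h(2) inj im by (simp add: order_prod_iff)
  qed
qed

section \<open>The order on finitely supported functions\<close>

lemma fin_suppD: "f \<in> fin_supp r \<Longrightarrow> f x \<noteq> 0 \<Longrightarrow> x \<in> Field r"
  by (auto simp: fin_supp_def)

lemma fin_supp_upd: "f \<in> fin_supp r \<Longrightarrow> x \<in> Field r \<Longrightarrow> f(x := k) \<in> fin_supp r"
proof -
  assume f: "f \<in> fin_supp r" and x: "x \<in> Field r"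
  have "{y. (f(x := k)) y \<noteq> 0} \<subseteq> insert x {y. f y \<noteq> 0}" by auto
  from finite_subset[OF this] this f x show ?thesis unfolding fin_supp_def by auto
qed

lemma fin_supp_add: "f \<in> fin_supp r \<Longrightarrow> g \<in> fin_supp r \<Longrightarrow> (\<lambda>x. f x + g x) \<in> fin_supp r"
proof -
  assume f: "f \<in> fin_supp r" and g: "g \<in> fin_supp r"
  have "{x. f x + g x \<noteq> 0} \<subseteq> {x. f x \<noteq> 0} \<union> {x. g x \<noteq> 0}" by auto
  from finite_subset[OF this] this f g show ?thesis unfolding fin_supp_def by auto
qed

lemma fin_supp_0: "(\<lambda>x. 0) \<in> fin_supp r"
  by (simp add: fin_supp_def)

lemma Field_Z_pow: "Field (Z_pow r) = fin_supp r"
  by (auto simp: Z_pow_def Field_def)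

lemma finite_linear_max:
  assumes "finite D" "D \<noteq> {}" "D \<subseteq> Field r" "Linear_order r"
  shows "\<exists>x\<in>D. \<forall>y\<in>D. (y, x) \<in> r"
  using assms(1-3)
proof (induction rule: finite_ne_induct)
  case (singleton x)
  then show ?case using assms(4) by (auto simp: order_on_defs refl_on_def)
next
  case (insert d D)
  then obtain x where x: "x \<in> D" "\<forall>y\<in>D. (y, x) \<in> r" by auto
  have d: "d \<in> Field r" "x \<in> Field r" using insert.prems x by auto
  have r: "refl_on (Field r) r" "total_on (Field r) r" "trans r"
    using assms(4) by (auto simp: order_on_defs)
  show ?case
  proof (cases "(d, x) \<in> r")
    case True
    with x show ?thesis by auto
  next
    case False
    with d r(1,2) have "(x, d) \<in> r" "(d, d) \<in> r"
      using Linear_order_cases[OF assms(4)] by blast+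
    moreover have "(y, d) \<in> r" if "y \<in> D" for y
      using x(2) that \<open>(x, d) \<in> r\<close> transD[OF r(3)] by blast
    ultimately show ?thesis by blast
  qed
qed

text \<open>Finite supports leave finitely many differences, so there is a greatest one. It decides
  the comparison of \<open>f\<close> and \<open>g\<close> and makes \<open>Z_pow r\<close>
  total.\<close>

lemma top_difference:
  assumes r: "Linear_order r" and f: "f \<in> fin_supp r" and g: "g \<in> fin_supp r" and ne: "f \<noteq> g"
  obtains x where "f x \<noteq> g x" "\<And>y. f y \<noteq> g y \<Longrightarrow> (y, x) \<in> r"
proof -
  have "{x. f x \<noteq> g x} \<subseteq> {x. f x \<noteq> 0} \<union> {x. g x \<noteq> 0}" by auto
  from finite_subset[OF this] this f g
  have "finite {x. f x \<noteq> g x}" "{x. f x \<noteq> g x} \<subseteq> Field r"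
    unfolding fin_supp_def by auto
  with finite_linear_max[of "{x. f x \<noteq> g x}" r] r ne that show ?thesis by fastforce
qed

lemma Z_powE:
  assumes "(f, g) \<in> Z_pow r" "f \<noteq> g"
  obtains x where "f x < g x" "\<And>y. f y \<noteq> g y \<Longrightarrow> (y, x) \<in> r"
  using assms unfolding Z_pow_def by blast

lemma Z_powI:
  assumes "f \<in> fin_supp r" "g \<in> fin_supp r" "f x < g x" "\<And>y. f y \<noteq> g y \<Longrightarrow> (y, x) \<in> r"
  shows "(f, g) \<in> Z_pow r"
  using assms unfolding Z_pow_def by blast

lemma Z_pow_D: "(f, g) \<in> Z_pow r \<Longrightarrow> f \<in> fin_supp r \<and> g \<in> fin_supp r"
  by (auto simp: Z_pow_def)

lemma Linear_order_Z_pow: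
  assumes r: "Linear_order r"
  shows "Linear_order (Z_pow r)"
proof -
  have r': "trans r" "antisym r" using r by (simp_all add: order_on_defs)
  have "refl_on (fin_supp r) (Z_pow r)" by (auto simp: Z_pow_def refl_on_def)
  moreover have "Z_pow r \<subseteq> fin_supp r \<times> fin_supp r" by (auto simp: Z_pow_def)
  moreover have "antisym (Z_pow r)"
  proof (rule antisymI, rule ccontr)
    fix f g
    assume fg: "(f, g) \<in> Z_pow r" "(g, f) \<in> Z_pow r" and ne: "f \<noteq> g"
    from fg(1) ne obtain x where x: "f x < g x" "\<And>y. f y \<noteq> g y \<Longrightarrow> (y, x) \<in> r" by (rule Z_powE) blast
    from fg(2) ne[symmetric] obtain y where y: "g y < f y" "\<And>z. g z \<noteq> f z \<Longrightarrow> (z, y) \<in> r"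
      by (rule Z_powE) blast
    from x y have "(x, y) \<in> r" "(y, x) \<in> r" by fastforce+
    with r'(2) have "x = y" by (auto dest: antisymD)
    with x(1) y(1) show False by simp
  qed
  moreover have "trans (Z_pow r)"
  proof (rule transI)
    fix f g h
    assume fg: "(f, g) \<in> Z_pow r" and gh: "(g, h) \<in> Z_pow r"
    show "(f, h) \<in> Z_pow r"
    proof (cases "f = g \<or> g = h")
      case True
      with fg gh show ?thesis by auto
    next
      case False
      from False have ne: "f \<noteq> g" "g \<noteq> h" by auto
      from fg ne(1) obtain x where x: "f x < g x" "\<And>y. f y \<noteq> g y \<Longrightarrow> (y, x) \<in> r"
        by (rule Z_powE) blast
      from gh ne(2) obtain z where z: "g z < h z" "\<And>y. g y \<noteq> h y \<Longrightarrow> (y, z) \<in> r"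
        by (rule Z_powE) blast
      have fs: "f \<in> fin_supp r" "h \<in> fin_supp r" using fg gh by (auto dest: Z_pow_D)
      have "(x, x) \<in> r" "(z, z) \<in> r" using x z by auto
      then have "x \<in> Field r" "z \<in> Field r" by (auto intro: FieldI1)
      \<comment> \<open>The larger of the top differences \<open>x\<close> of \<open>f, g\<close>
        and \<open>z\<close> of \<open>g, h\<close> is a top difference of \<open>f\<close> and
        \<open>h\<close>: the other pair agrees there, or \<open>x = z\<close> and the two
        inequalities chain.\<close>
      with r show ?thesis
      proof (cases rule: Linear_order_cases)
        case 1
        have "f z < h z"
        proof (cases "z = x")
          case False
          with 1 x(2)[of z] r'(2) have "f z = g z" by (auto dest: antisymD)
          with z show ?thesis by simp
        qed (use x z in auto)
        moreover have "(w, z) \<in> r" if "f w \<noteq> h w" for w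
          using that x(2)[of w] z(2)[of w] 1 r'(1) by (cases "f w = g w") (auto dest: transD)
        ultimately show ?thesis using fs by (intro Z_powI[where x = z])
      next
        case 2
        have "f x < h x"
        proof (cases "z = x")
          case False
          with 2 z(2)[of x] r'(2) have "g x = h x" by (auto dest: antisymD)
          with x show ?thesis by simp
        qed (use x z in auto)
        moreover have "(w, x) \<in> r" if "f w \<noteq> h w" for w
          using that x(2)[of w] z(2)[of w] 2 r'(1) by (cases "f w = g w") (auto dest: transD)
        ultimately show ?thesis using fs by (intro Z_powI[where x = x])
      qed
    qed
  qed
  moreover have "total_on (fin_supp r) (Z_pow r)"
  proof (rule total_onI)
    fix f g assume fg: "f \<in> fin_supp r" "g \<in> fin_supp r" "f \<noteq> g"
    with r obtain x where x: "f x \<noteq> g x" "\<And>y. f y \<noteq> g y \<Longrightarrow> (y, x) \<in> r"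
      by (rule top_difference) blast
    then consider "f x < g x" | "g x < f x" by linarith
    then show "(f, g) \<in> Z_pow r \<or> (g, f) \<in> Z_pow r"
    proof cases
      case 1
      with fg x show ?thesis by (blast intro: Z_powI)
    next
      case 2
      with fg x show ?thesis by (metis Z_powI)
    qed
  qed
  ultimately show ?thesis unfolding order_on_defs Field_Z_pow by blast
qed

lemma Z_pow_add_right:
  assumes "(f, g) \<in> Z_pow r" "h \<in> fin_supp r"
  shows "(\<lambda>x. f x + h x, \<lambda>x. g x + h x) \<in> Z_pow r"
proof (cases "f = g")
  case True
  with assms show ?thesis by (simp add: Z_pow_def fin_supp_add)
next
  case False
  with assms(1) obtain x where "f x < g x" "\<And>y. f y \<noteq> g y \<Longrightarrow> (y, x) \<in> r" by (rule Z_powE) blast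
  with assms show ?thesis
    by (intro Z_powI[where x = x] fin_supp_add) (auto dest: Z_pow_D)
qed

lemma Z_pow_upd:
  assumes r: "Linear_order r" and f: "f \<in> fin_supp r" and x: "x \<in> Field r" and "f x \<le> k"
  shows "(f, f(x := k)) \<in> Z_pow r"
proof (cases "f x = k")
  case True
  then have "f(x := k) = f" by auto
  with f show ?thesis by (simp add: Z_pow_def)
next
  case False
  with assms show ?thesis
    by (intro Z_powI[where x = x] fin_supp_upd)
      (auto simp: order_on_defs refl_on_def split: if_splits)
qed


section \<open>Invariance of the exponent\<close>

text \<open>The pairs are points of a product of Z^r with a further order. For
  \<open>A = under r x\<close> this is equality strictly above \<open>x\<close>, for
  \<open>A = underS r x\<close> equality at and above \<open>x\<close>, in both cases with equal
  second coordinates.\<close>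

definition agree_off :: "'a set \<Rightarrow> ('a \<Rightarrow> int) \<times> 'c \<Rightarrow> ('a \<Rightarrow> int) \<times> 'c \<Rightarrow> bool" where
  "agree_off A u v \<longleftrightarrow> snd u = snd v \<and> (\<forall>x. fst u x \<noteq> fst v x \<longrightarrow> x \<in> A)"

text \<open>
  One step of finite condensation: it turns ``equal at and above \<open>x\<close>'' into ``equal above \<open>x\<close>''
  (\<open>fin_classes_between_iff\<close>) and is defined from the order alone, so that isomorphisms preserve
  all levels of the hierarchy of these equivalences.
\<close>

definition fin_classes_between :: "'a rel \<Rightarrow> ('a \<Rightarrow> 'a \<Rightarrow> bool) \<Rightarrow> 'a \<Rightarrow> 'a \<Rightarrow> bool" where
  "fin_classes_between R E u v \<longleftrightarrow>
    (\<exists>n. \<forall>K. finite K \<longrightarrow> (\<forall>k\<in>K. (u, k) \<in> R \<and> (k, v) \<in> R) \<longrightarrow>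
      (\<forall>k\<in>K. \<forall>l\<in>K. k \<noteq> l \<longrightarrow> \<not> E k l) \<longrightarrow> card K \<le> n)"

text \<open>Finite sets move along \<open>h\<close> in both directions without changing their
  cardinality. \<open>E\<close> and \<open>E'\<close> are parameters, so that a correspondence of
  finer equivalences yields one of the condensed equivalences.\<close>

lemma fin_classes_between_iso:
  assumes h: "bij_betw h (Field R) (Field S)"
    "\<And>x y. x \<in> Field R \<Longrightarrow> y \<in> Field R \<Longrightarrow> (h x, h y) \<in> S \<longleftrightarrow> (x, y) \<in> R"
    and E: "\<And>x y. x \<in> Field R \<Longrightarrow> y \<in> Field R \<Longrightarrow> E' (h x) (h y) \<longleftrightarrow> E x y"
    and uv: "u \<in> Field R" "v \<in> Field R"
  shows "fin_classes_between S E' (h u) (h v) \<longleftrightarrow> fin_classes_between R E u v"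
proof
  have inj: "inj_on h (Field R)" using h(1) by (simp add: bij_betw_def)
  have inj_iff: "h x = h y \<longleftrightarrow> x = y" if "x \<in> Field R" "y \<in> Field R" for x y
    using inj that by (simp add: inj_on_eq_iff)
  {
    assume "fin_classes_between S E' (h u) (h v)"
    then obtain n where n: "\<And>K. finite K \<Longrightarrow> (\<forall>k\<in>K. (h u, k) \<in> S \<and> (k, h v) \<in> S) \<Longrightarrow>
      (\<forall>k\<in>K. \<forall>l\<in>K. k \<noteq> l \<longrightarrow> \<not> E' k l) \<Longrightarrow> card K \<le> n"
      unfolding fin_classes_between_def by blast
    show "fin_classes_between R E u v"
      unfolding fin_classes_between_def
    proof (intro exI[of _ n] allI impI)
      fix K
      assume K: "finite K" "\<forall>k\<in>K. (u, k) \<in> R \<and> (k, v) \<in> R" "\<forall>k\<in>K. \<forall>l\<in>K. k \<noteq> l \<longrightarrow> \<not> E k l"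
      then have sub: "k \<in> Field R" if "k \<in> K" for k using that by (auto intro: FieldI1)
      have "card (h ` K) \<le> n"
        using K sub uv by (intro n) (auto simp: h(2) E)
      moreover have "card (h ` K) = card K"
        using sub inj by (intro card_image inj_on_subset[OF inj]) auto
      ultimately show "card K \<le> n" by simp
    qed
  }
  {
    assume "fin_classes_between R E u v"
    then obtain n where n: "\<And>K. finite K \<Longrightarrow> (\<forall>k\<in>K. (u, k) \<in> R \<and> (k, v) \<in> R) \<Longrightarrow>
      (\<forall>k\<in>K. \<forall>l\<in>K. k \<noteq> l \<longrightarrow> \<not> E k l) \<Longrightarrow> card K \<le> n"
      unfolding fin_classes_between_def by blast
    show "fin_classes_between S E' (h u) (h v)"
      unfolding fin_classes_between_def
    proof (intro exI[of _ n] allI impI)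
      fix K
      assume K: "finite K" "\<forall>k\<in>K. (h u, k) \<in> S \<and> (k, h v) \<in> S"
        "\<forall>k\<in>K. \<forall>l\<in>K. k \<noteq> l \<longrightarrow> \<not> E' k l"
      then have "K \<subseteq> h ` Field R" using h(1) by (auto simp: bij_betw_def intro: FieldI1)
      then obtain L where L: "L \<subseteq> Field R" "inj_on h L" "K = h ` L"
        unfolding subset_image_inj by blast
      have sub: "k \<in> Field R" if "k \<in> L" for k using L that by blast
      have "card L \<le> n"
        using K L sub uv by (intro n) (auto simp: h(2) E inj_iff finite_image_iff)
      then show "card K \<le> n" using L by (simp add: card_image)
    qed
  }
qed

section \<open>Condensation classes in a product of Z^r with a linear order\<close>

context
  fixes r :: "'a rel" and S :: "'c rel"
  assumes r: "Linear_order r" and S: "Linear_order S"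
begin

lemma Field_prod_Z_pow: "Field (order_prod (Z_pow r) S) = fin_supp r \<times> Field S"
  using Linear_order_Z_pow[OF r] S by (simp add: Field_order_prod Field_Z_pow order_on_defs)

text \<open>Either the values at \<open>x\<close> agree, or \<open>x\<close> is itself the greatest
  difference, where the order is decided.\<close>

lemma Z_pow_le_at:
  assumes "(f, g) \<in> Z_pow r" and within: "\<And>y. f y \<noteq> g y \<Longrightarrow> (y, x) \<in> r"
  shows "f x \<le> g x"
proof (cases "f = g")
  case False
  with assms(1) obtain y where y: "f y < g y" "\<And>z. f z \<noteq> g z \<Longrightarrow> (z, y) \<in> r"
    by (rule Z_powE) blast
  show ?thesis
  proof (cases "f x = g x")
    case False
    with y within have "(x, y) \<in> r" "(y, x) \<in> r" by auto
    with r have "x = y" by (auto simp: order_on_defs dest: antisymD)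
    with y show ?thesis by simp
  qed simp
qed simp

lemma Z_pow_convex:
  assumes "(f, k) \<in> Z_pow r" "(k, g) \<in> Z_pow r" and within: "\<And>y. f y \<noteq> g y \<Longrightarrow> (y, x) \<in> r"
    and "f y \<noteq> k y"
  shows "(y, x) \<in> r"
proof -
  have r': "trans r" "antisym r" using r by (simp_all add: order_on_defs)
  from assms(4) have "f \<noteq> k" by auto
  with assms(1) obtain t where t: "f t < k t" "\<And>y. f y \<noteq> k y \<Longrightarrow> (y, t) \<in> r"
    by (rule Z_powE) blast
  \<comment> \<open>If \<open>f\<close> and \<open>g\<close> agree at \<open>t\<close>, then
    \<open>k\<close> differs from \<open>g\<close> there, so the top difference \<open>s\<close> of
    \<open>k\<close> and \<open>g\<close> is at or above \<open>t\<close>. At \<open>s\<close> the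
    functions \<open>f\<close> and \<open>g\<close> must differ, for otherwise \<open>s = t\<close>
    and \<open>f t < k t < g t = f t\<close>. Hence \<open>t \<le> s \<le> x\<close> in
    \<open>r\<close>.\<close>
  have "(t, x) \<in> r"
  proof (cases "f t = g t")
    case True
    with t have "k \<noteq> g" by auto
    with assms(2) obtain s where s: "k s < g s" "\<And>y. k y \<noteq> g y \<Longrightarrow> (y, s) \<in> r"
      by (rule Z_powE) blast
    have ts: "(t, s) \<in> r" using s(2)[of t] True t(1) by simp
    have "f s \<noteq> g s"
    proof
      assume eq: "f s = g s"
      with s t have "(s, t) \<in> r" by simp
      with ts r' have "s = t" by (auto dest: antisymD)
      with eq s t show False by simp
    qed
    with within ts r' show ?thesis by (auto dest: transD)
  qed (rule within)
  with t(2) assms(4) r' show ?thesis by (auto dest: transD)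
qed

text \<open>Antisymmetry of \<open>S\<close> squeezes the second coordinates, and
  \<open>Z_pow_convex\<close> treats the functions. As a consequence only finitely many values at
  \<open>x\<close> occur between \<open>u\<close> and \<open>v\<close>.\<close>

lemma order_prod_convex:
  assumes "(u, k) \<in> order_prod (Z_pow r) S" "(k, v) \<in> order_prod (Z_pow r) S"
    and uv: "agree_off (under r x) u v"
  shows "agree_off (under r x) u k" "agree_off (under r x) k v"
    "fst u x \<le> fst k x" "fst k x \<le> fst v x"
proof -
  obtain f a where u: "u = (f, a)" by (cases u)
  obtain g b where k: "k = (g, b)" by (cases k)
  obtain h c where v: "v = (h, c)" by (cases v)
  have ac: "a = c" and within: "\<And>y. f y \<noteq> h y \<Longrightarrow> (y, x) \<in> r"
    using uv by (auto simp: agree_off_def u v under_def)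
  have "b = a"
    using assms(1,2) S unfolding u k v ac order_prod_iff
    by (auto simp: order_on_defs dest: antisymD)
  with assms(1,2) have fg: "(f, g) \<in> Z_pow r" "(g, h) \<in> Z_pow r"
    by (auto simp: u k v ac order_prod_iff)
  note w1 = Z_pow_convex[OF fg within]
  have w2: "(y, x) \<in> r" if "g y \<noteq> h y" for y
    using that w1[of y] within[of y] by (cases "f y = g y") auto
  show "agree_off (under r x) u k" "agree_off (under r x) k v"
    using w1 w2 \<open>b = a\<close> ac by (auto simp: agree_off_def u k v under_def)
  show "fst u x \<le> fst k x" "fst k x \<le> fst v x"
    using Z_pow_le_at[OF fg(1) w1] Z_pow_le_at[OF fg(2) w2] by (simp_all add: u k v)
qed

lemma agree_off_under_cases:
  assumes "agree_off (under r x) u v" "fst u x = fst v x"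
  shows "agree_off (underS r x) u v"
  using assms by (auto simp: agree_off_def under_def underS_def)

text \<open>The greatest difference \<open>z\<close> of two distinct functions puts them into one
  class at level \<open>z\<close>. So equality at and above \<open>x\<close> is the union of the
  levels below \<open>x\<close>, or mere equality if there are none, and a single induction step
  covers least, successor and limit elements.\<close>

lemma agree_off_underS_iff:
  assumes u: "u \<in> Field (order_prod (Z_pow r) S)" and v: "v \<in> Field (order_prod (Z_pow r) S)"
  shows "agree_off (underS r x) u v \<longleftrightarrow> u = v \<or> (\<exists>z\<in>underS r x. agree_off (under r z) u v)"
proof
  assume uv: "agree_off (underS r x) u v"
  show "u = v \<or> (\<exists>z\<in>underS r x. agree_off (under r z) u v)"
  proof (cases "fst u = fst v")
    case False
    from u v have "fst u \<in> fin_supp r" "fst v \<in> fin_supp r" by (auto simp: Field_prod_Z_pow)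
    with False r obtain z where "fst u z \<noteq> fst v z" "\<And>y. fst u y \<noteq> fst v y \<Longrightarrow> (y, z) \<in> r"
      by (metis top_difference)
    with uv have "z \<in> underS r x" "agree_off (under r z) u v"
      by (auto simp: agree_off_def under_def)
    then show ?thesis by blast
  qed (use uv in \<open>simp add: agree_off_def prod_eq_iff\<close>)
next
  have r': "trans r" "antisym r" using r by (simp_all add: order_on_defs)
  assume "u = v \<or> (\<exists>z\<in>underS r x. agree_off (under r z) u v)"
  then show "agree_off (underS r x) u v"
  proof
    assume "\<exists>z\<in>underS r x. agree_off (under r z) u v"
    then obtain z where z: "(z, x) \<in> r" "z \<noteq> x" "agree_off (under r z) u v"
      by (auto simp: underS_def)
    have "y \<in> underS r x" if "(y, z) \<in> r" for y
      using z(1,2) that r' by (auto simp: underS_def dest: transD antisymD)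
    with z(3) show ?thesis by (auto simp: agree_off_def under_def)
  qed (simp add: agree_off_def)
qed

text \<open>Among points equal above \<open>x\<close>, the finer classes are told apart by the
  integer at \<open>x\<close>, and between \<open>u\<close> and \<open>v\<close> it ranges over
  \<open>{fst u x..fst v x}\<close>. If instead \<open>u\<close> and \<open>v\<close> differ above
  \<open>x\<close> or in \<open>S\<close>, raising \<open>u\<close> at \<open>x\<close> by any
  amount stays below \<open>v\<close> and gives arbitrarily many classes.\<close>

lemma fin_classes_between_iff:
  assumes uv: "(u, v) \<in> order_prod (Z_pow r) S" and x: "x \<in> Field r"
  shows "fin_classes_between (order_prod (Z_pow r) S) (agree_off (underS r x)) u v
    \<longleftrightarrow> agree_off (under r x) u v"
proof
  let ?X = "order_prod (Z_pow r) S"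
  assume agree: "agree_off (under r x) u v"
  show "fin_classes_between ?X (agree_off (underS r x)) u v"
    unfolding fin_classes_between_def
  proof (intro exI allI impI)
    fix K
    assume K: "finite K" "\<forall>k\<in>K. (u, k) \<in> ?X \<and> (k, v) \<in> ?X"
      "\<forall>k\<in>K. \<forall>l\<in>K. k \<noteq> l \<longrightarrow> \<not> agree_off (underS r x) k l"
    have "inj_on (\<lambda>k. fst k x) K"
    proof (rule inj_onI, rule ccontr)
      fix k l assume kl: "k \<in> K" "l \<in> K" "fst k x = fst l x" "k \<noteq> l"
      have "agree_off (under r x) u k" "agree_off (under r x) u l"
        using K(2) kl agree by (blast intro: order_prod_convex)+
      then have "agree_off (under r x) k l"
        unfolding agree_off_def by metis
      with kl K(3) agree_off_under_cases show False by blast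
    qed
    moreover have "(\<lambda>k. fst k x) ` K \<subseteq> {fst u x..fst v x}"
      using K(2) order_prod_convex(3,4)[OF _ _ agree] by auto
    ultimately show "card K \<le> card {fst u x..fst v x}"
      by (rule card_inj_on_le) simp
  qed
next
  let ?X = "order_prod (Z_pow r) S"
  have r': "trans r" "antisym r" "refl_on (Field r) r" using r by (simp_all add: order_on_defs)
  obtain f a where u: "u = (f, a)" by (cases u)
  obtain g b where v: "v = (g, b)" by (cases v)
  have fs: "f \<in> fin_supp r" "g \<in> fin_supp r" and ab: "a \<in> Field S" "b \<in> Field S"
    using uv by (auto simp: u v order_prod_iff Field_Z_pow)
  assume "fin_classes_between ?X (agree_off (underS r x)) u v"
  then obtain n where n: "\<And>K. finite K \<Longrightarrow> (\<forall>k\<in>K. (u, k) \<in> ?X \<and> (k, v) \<in> ?X) \<Longrightarrow>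
      (\<forall>k\<in>K. \<forall>l\<in>K. k \<noteq> l \<longrightarrow> \<not> agree_off (underS r x) k l) \<Longrightarrow> card K \<le> n"
    unfolding fin_classes_between_def by blast
  show "agree_off (under r x) u v"
  proof (rule ccontr)
    assume not: "\<not> agree_off (under r x) u v"
    define k where "k i = (f(x := f x + int i), a)" for i :: nat
    have "(u, k i) \<in> ?X" for i
      using Z_pow_upd[OF r fs(1) x, of "f x + int i"] fin_supp_upd[OF fs(1) x] fs ab S
      by (auto simp: u k_def order_prod_iff Field_Z_pow)
    moreover have "(k i, v) \<in> ?X" for i
    proof (cases "a = b")
      case False
      with uv fin_supp_upd[OF fs(1) x] show ?thesis
        by (auto simp: u v k_def order_prod_iff Field_Z_pow)
    next
      case True
      with not have "f \<noteq> g" by (auto simp: u v agree_off_def)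
      moreover have "(f, g) \<in> Z_pow r" using uv True by (auto simp: u v order_prod_iff)
      ultimately obtain t where t: "f t < g t" "\<And>y. f y \<noteq> g y \<Longrightarrow> (y, t) \<in> r"
        by (metis Z_powE)
      have "(t, t) \<in> r" using t by simp
      \<comment> \<open>So \<open>x\<close> lies strictly below the deciding point \<open>t\<close>,
        and changes at \<open>x\<close> do not affect the comparison with \<open>g\<close>.\<close>
      have "(t, x) \<notin> r"
      proof
        assume "(t, x) \<in> r"
        with t(2) r'(1) have "\<And>y. f y \<noteq> g y \<Longrightarrow> (y, x) \<in> r" by (auto dest: transD)
        with not True show False by (auto simp: u v agree_off_def under_def)
      qed
      with r x \<open>(t, t) \<in> r\<close> have xt: "(x, t) \<in> r" "x \<noteq> t"
        by (metis FieldI1 Linear_order_cases)+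
      have "(f(x := f x + int i), g) \<in> Z_pow r"
        using t xt fs x by (intro Z_powI[where x = t] fin_supp_upd) (auto split: if_splits)
      with True ab show ?thesis
        using fs fin_supp_upd[OF fs(1) x] by (auto simp: v k_def order_prod_iff Field_Z_pow)
    qed
    moreover have "\<not> agree_off (underS r x) (k i) (k j)" if "i \<noteq> j" for i j
      using that by (auto simp: agree_off_def underS_def k_def)
    ultimately have "card (k ` {..n}) \<le> n"
      by (intro n) (auto, metis)
    moreover have "inj k" by (rule injI) (auto simp: k_def dest: fun_cong[of _ _ x])
    ultimately show False by (simp add: card_image inj_on_def)
  qed
qed

end

lemma agree_off_sym: "agree_off A u v \<longleftrightarrow> agree_off A v u"
  by (auto simp: agree_off_def)

text \<open>One-point orders satisfy this vacuously, so that both values of \<epsilon> fall under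
  one hypothesis on the second factor.\<close>

definition order_dense :: "'a rel \<Rightarrow> bool" where
  "order_dense r \<longleftrightarrow> (\<forall>x y. (x, y) \<in> r \<longrightarrow> x \<noteq> y \<longrightarrow>
    (\<exists>z. (x, z) \<in> r \<and> (z, y) \<in> r \<and> z \<noteq> x \<and> z \<noteq> y))"

text \<open>If \<alpha> were shorter, it would be a copy of the part of \<open>r\<close> below some
  \<open>x0\<close>, and the isomorphism would match its levels with those of \<open>r\<close> below
  \<open>x0\<close>. Collapsing them all leaves \<open>S\<close> on the right, which has no adjacent
  points, but adjacent classes on the left, given by the integers at \<open>x0\<close>. The
  one-point factor \<open>P\<close> turns the left side into a product, so that the same lemmas
  apply to both sides.\<close>

lemma ordLeq_of_Z_pow_iso:
  includes cardinal_syntax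
  fixes r :: "'a rel" and \<alpha> :: "'b rel" and S :: "'c rel" and P :: "'d rel"
  assumes r: "Well_order r" and \<alpha>: "Well_order \<alpha>"
    and P: "Linear_order P" "Field P = {s0}"
    and S: "Linear_order S" "order_dense S"
    and iso: "order_isomorphic (order_prod (Z_pow r) P) (order_prod (Z_pow \<alpha>) S)"
  shows "r \<le>o \<alpha>"
proof (rule ccontr)
  assume "\<not> r \<le>o \<alpha>"
  with r \<alpha> have "\<alpha> <o r" by (simp add: not_ordLeq_iff_ordLess)
  then obtain x0 where x0: "x0 \<in> Field r" "\<alpha> =o Restr r (underS r x0)"
    using r \<alpha> ordLess_iff_ordIso_Restr by blast
  have r': "Linear_order r" "trans r" "antisym r" "refl_on (Field r) r"
    and \<alpha>': "Linear_order \<alpha>" "wf (\<alpha> - Id)" "refl_on (Field \<alpha>) \<alpha>"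
    using r \<alpha> by (simp_all add: order_on_defs)
  have FR: "Field (Restr r (underS r x0)) = underS r x0"
    using Refl_Field_Restr2[of r "underS r x0"] r'(4) Order_Relation.underS_Field[of r x0]
    by simp
  from x0(2) obtain \<psi> where "BNF_Wellorder_Embedding.iso \<alpha> (Restr r (underS r x0)) \<psi>" by (auto simp: ordIso_def)
  then have \<psi>: "bij_betw \<psi> (Field \<alpha>) (underS r x0)"
    "\<And>x y. x \<in> Field \<alpha> \<Longrightarrow> y \<in> Field \<alpha> \<Longrightarrow> (x, y) \<in> \<alpha> \<longleftrightarrow> (\<psi> x, \<psi> y) \<in> r"
    unfolding BNF_Wellorder_Embedding.iso_iff2 FR by (auto simp: bij_betw_def)
  have inj\<psi>: "\<psi> x = \<psi> y \<longleftrightarrow> x = y" if "x \<in> Field \<alpha>" "y \<in> Field \<alpha>" for x y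
    using \<psi>(1) that by (auto simp: bij_betw_def inj_on_def)
  have im\<psi>: "\<psi> ` Field \<alpha> = underS r x0" using \<psi>(1) by (simp add: bij_betw_def)
  have \<psi>_Field: "\<psi> y \<in> Field r" if "y \<in> Field \<alpha>" for y
    using im\<psi> that by (auto simp: underS_def intro: FieldI1)
  have underS_\<psi>: "underS r (\<psi> y) = \<psi> ` underS \<alpha> y" if y: "y \<in> Field \<alpha>" for y
  proof
    have "\<psi> x \<in> underS r (\<psi> y)" if "x \<noteq> y" "(x, y) \<in> \<alpha>" for x
      using y that \<psi>(2)[of x y] inj\<psi>[of x y] FieldI1[OF that(2)] by (simp add: underS_def)
    then show "\<psi> ` underS \<alpha> y \<subseteq> underS r (\<psi> y)"
      by (auto simp: underS_def[of \<alpha>])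
    show "underS r (\<psi> y) \<subseteq> \<psi> ` underS \<alpha> y"
    proof
      fix z assume z: "z \<in> underS r (\<psi> y)"
      have "\<psi> y \<in> underS r x0" using y im\<psi> by blast
      with z r'(2,3) have "z \<in> underS r x0" by (auto simp: underS_def dest: transD antisymD)
      then obtain w where w: "w \<in> Field \<alpha>" "z = \<psi> w" using im\<psi> by blast
      with z y \<psi>(2) show "z \<in> \<psi> ` underS \<alpha> y" by (auto simp: underS_def)
    qed
  qed
  let ?X = "order_prod (Z_pow r) P" and ?Y = "order_prod (Z_pow \<alpha>) S"
  have FX: "Field ?X = fin_supp r \<times> {s0}" and FY: "Field ?Y = fin_supp \<alpha> \<times> Field S"
    using Field_prod_Z_pow[OF r'(1) P(1)] Field_prod_Z_pow[OF \<alpha>'(1) S(1)] P(2) by simp_all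
  from iso obtain h where h: "bij_betw h (Field ?X) (Field ?Y)"
    "\<And>x y. x \<in> Field ?X \<Longrightarrow> y \<in> Field ?X \<Longrightarrow> (h x, h y) \<in> ?Y \<longleftrightarrow> (x, y) \<in> ?X"
    by (rule order_isomorphicE) blast
  have inj: "h x = h y \<longleftrightarrow> x = y" if "x \<in> Field ?X" "y \<in> Field ?X" for x y
    using h(1) that by (auto simp: bij_betw_def inj_on_def)
  have im: "h x \<in> Field ?Y" if "x \<in> Field ?X" for x
    using h(1) that by (auto simp: bij_betw_def)
  have LX: "Linear_order ?X"
    by (intro Linear_order_order_prod Linear_order_Z_pow r' P)
  \<comment> \<open>Level \<open>y\<close> of \<alpha> corresponds to level \<open>\<psi> y\<close>
    of \<open>r\<close>. The smaller levels yield the correspondence for equality at and above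
    \<open>y\<close>, and one finite condensation leads from there to level
    \<open>y\<close>.\<close>
  have key: "\<forall>u\<in>Field ?X. \<forall>v\<in>Field ?X.
      agree_off (under \<alpha> y) (h u) (h v) \<longleftrightarrow> agree_off (under r (\<psi> y)) u v"
    if "y \<in> Field \<alpha>" for y
    using \<alpha>'(2) that
  proof (induction y rule: wf_induct_rule)
    case (less y)
    have step: "agree_off (underS \<alpha> y) (h u) (h v) \<longleftrightarrow> agree_off (underS r (\<psi> y)) u v"
      if uv: "u \<in> Field ?X" "v \<in> Field ?X" for u v
    proof -
      have "agree_off (under \<alpha> z) (h u) (h v) \<longleftrightarrow> agree_off (under r (\<psi> z)) u v"
        if "z \<in> underS \<alpha> y" for z
        using less.IH[of z] that uv by (auto simp: underS_def dest: FieldI1)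
      then show ?thesis
        unfolding agree_off_underS_iff[OF r'(1) P(1) uv]
          agree_off_underS_iff[OF \<alpha>'(1) S(1) im[OF uv(1)] im[OF uv(2)]]
        unfolding underS_\<psi>[OF less.prems] inj[OF uv] by simp
    qed
    \<comment> \<open>If \<open>v\<close> is strictly below \<open>u\<close>, no point lies between
      them and the counting condition is trivially true. So the ordered case is treated here, and
      symmetry does the rest.\<close>
    have le: "agree_off (under \<alpha> y) (h u) (h v) \<longleftrightarrow> agree_off (under r (\<psi> y)) u v"
      if uv: "(u, v) \<in> ?X" for u v
    proof -
      have F: "u \<in> Field ?X" "v \<in> Field ?X" using uv by (auto intro: FieldI1 FieldI2)
      then have "(h u, h v) \<in> ?Y" using h(2) uv by blast
      from fin_classes_between_iff[OF \<alpha>'(1) S(1) this less.prems]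
        fin_classes_between_iff[OF r'(1) P(1) uv \<psi>_Field[OF less.prems]]
        fin_classes_between_iso[where E' = "agree_off (underS \<alpha> y)"
          and E = "agree_off (underS r (\<psi> y))", OF h step F]
      show ?thesis by simp
    qed
    show ?case
    proof (intro ballI)
      fix u v assume "u \<in> Field ?X" "v \<in> Field ?X"
      with LX consider "(u, v) \<in> ?X" | "(v, u) \<in> ?X" by (rule Linear_order_cases)
      then show "agree_off (under \<alpha> y) (h u) (h v) \<longleftrightarrow> agree_off (under r (\<psi> y)) u v"
      proof cases
        case 2
        from le[OF 2] show ?thesis
          by (simp only: agree_off_sym[of _ u v] agree_off_sym[of _ "h u" "h v"])
      qed (rule le)
    qed
  qed
  \<comment> \<open>Equal \<open>S\<close>-coordinates mean equality or agreement at some level of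
    \<alpha>, and these levels match exactly those of \<open>r\<close> below
    \<open>x0\<close>.\<close>
  have same: "snd (h u) = snd (h v) \<longleftrightarrow> agree_off (underS r x0) u v"
    if uv: "u \<in> Field ?X" "v \<in> Field ?X" for u v
  proof
    assume "agree_off (underS r x0) u v"
    then consider "u = v" | z where "z \<in> underS r x0" "agree_off (under r z) u v"
      using agree_off_underS_iff[OF r'(1) P(1) uv] by blast
    then show "snd (h u) = snd (h v)"
    proof cases
      case 2
      then obtain y where "y \<in> Field \<alpha>" "z = \<psi> y" using im\<psi> by blast
      with key uv 2 show ?thesis by (auto simp: agree_off_def)
    qed simp
  next
    assume eq: "snd (h u) = snd (h v)"
    show "agree_off (underS r x0) u v"
    proof (cases "fst (h u) = fst (h v)")
      case True
      with eq have "h u = h v" by (simp add: prod_eq_iff)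
      with inj uv have "u = v" by blast
      then show ?thesis by (simp add: agree_off_def)
    next
      case False
      have "fst (h u) \<in> fin_supp \<alpha>" "fst (h v) \<in> fin_supp \<alpha>"
        using im uv by (auto simp: FY mem_Times_iff)
      with False \<alpha>'(1) obtain y where y: "fst (h u) y \<noteq> fst (h v) y"
          "\<And>z. fst (h u) z \<noteq> fst (h v) z \<Longrightarrow> (z, y) \<in> \<alpha>"
        by (metis top_difference)
      from y(2)[OF y(1)] have yF: "y \<in> Field \<alpha>" by (rule FieldI1)
      have "agree_off (under \<alpha> y) (h u) (h v)"
        using y eq by (auto simp: agree_off_def under_def)
      with key[OF yF] uv have "agree_off (under r (\<psi> y)) u v" by blast
      moreover have "\<psi> y \<in> underS r x0" using yF im\<psi> by blast
      ultimately show ?thesis using agree_off_underS_iff[OF r'(1) P(1) uv] by blast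
    qed
  qed
  \<comment> \<open>Two points in adjacent classes: equal above \<open>x0\<close>, with values 0 and
    1 at \<open>x0\<close>.\<close>
  define u where "u = ((\<lambda>x. 0) :: 'a \<Rightarrow> int, s0)"
  define v where "v = ((\<lambda>x. 0)(x0 := 1) :: 'a \<Rightarrow> int, s0)"
  have u: "u \<in> Field ?X" and v: "v \<in> Field ?X"
    unfolding FX u_def v_def using fin_supp_0[of r] fin_supp_upd[OF fin_supp_0 x0(1)] by blast+
  have "(u, v) \<in> ?X"
    using Z_pow_upd[OF r'(1) fin_supp_0 x0(1), of 1] fin_supp_0[of r]
      fin_supp_upd[OF fin_supp_0 x0(1), of 1] P
    by (auto simp: u_def v_def order_prod_iff Field_Z_pow order_on_defs refl_on_def)
  then have huv: "(h u, h v) \<in> ?Y" using h(2) u v by blast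
  have uv: "agree_off (under r x0) u v" "\<not> agree_off (underS r x0) u v"
    using x0(1) r'(4) by (auto simp: u_def v_def agree_off_def under_def underS_def refl_on_def)
  with same[OF u v] have ne: "snd (h u) \<noteq> snd (h v)" by simp
  with huv have "(snd (h u), snd (h v)) \<in> S"
    by (auto simp: order_prod_def split: prod.splits)
  with S(2) ne obtain t where t: "(snd (h u), t) \<in> S" "(t, snd (h v)) \<in> S"
    "t \<noteq> snd (h u)" "t \<noteq> snd (h v)"
    unfolding order_dense_def by blast
  \<comment> \<open>A point over \<open>t\<close> has a preimage \<open>k\<close> between
    \<open>u\<close> and \<open>v\<close>. Its value at \<open>x0\<close> is 0 or 1, so it shares a
    class with \<open>u\<close> or \<open>v\<close>, whereas \<open>t\<close> differs from both
    second coordinates.\<close>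
  have "(fst (h u), t) \<in> Field ?Y"
    using im[OF u] t(1) by (auto simp: FY mem_Times_iff intro: FieldI2)
  then obtain k where k: "k \<in> Field ?X" "h k = (fst (h u), t)"
    using h(1) by (metis bij_betw_def imageE)
  obtain f a g b where fa: "h u = (f, a)" "h v = (g, b)" by (metis surj_pair)
  have "f \<in> fin_supp \<alpha>" "g \<in> fin_supp \<alpha>" "a \<in> Field S" "b \<in> Field S" "t \<in> Field S"
    using im[OF u] im[OF v] t(1) unfolding FY fa by (auto intro: FieldI2)
  then have "(h u, h k) \<in> ?Y" "(h k, h v) \<in> ?Y"
    using t unfolding k(2) fa order_prod_iff Field_Z_pow by simp_all
  then have "(u, k) \<in> ?X" "(k, v) \<in> ?X" using h(2) u v k by blast+
  note c = order_prod_convex[OF r'(1) P(1) this uv(1)]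
  from c(3,4) have "fst k x0 = fst u x0 \<or> fst k x0 = fst v x0"
    by (auto simp: u_def v_def)
  then have "agree_off (underS r x0) u k \<or> agree_off (underS r x0) k v"
    using agree_off_under_cases[OF r'(1) P(1) c(1)] agree_off_under_cases[OF r'(1) P(1) c(2)]
    by auto
  with same[OF u k(1)] same[OF k(1) v] k(2) t show False by auto
qed


section \<open>Countable dense orders and the order type of \<open>\<int>\<^sup>r\<close>\<close>

definition dense_unbounded :: "'a rel \<Rightarrow> bool" where
  "dense_unbounded r \<longleftrightarrow> Linear_order r \<and> Field r \<noteq> {} \<and> order_dense r \<and>
    (\<forall>x\<in>Field r. \<exists>y. (y, x) \<in> r \<and> y \<noteq> x) \<and> (\<forall>x\<in>Field r. \<exists>y. (x, y) \<in> r \<and> y \<noteq> x)"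

text \<open>\<open>L\<close> and \<open>U\<close> enter only through the maximum of \<open>L\<close>
  and the minimum of \<open>U\<close>. Density serves if both exist, the absence of endpoints if one
  does, nonemptiness of the field if neither does.\<close>

lemma dense_unbounded_between:
  assumes r: "dense_unbounded r"
    and fin: "finite L" "finite U" and sub: "L \<subseteq> Field r" "U \<subseteq> Field r"
    and less: "\<And>l u. l \<in> L \<Longrightarrow> u \<in> U \<Longrightarrow> (l, u) \<in> r \<and> l \<noteq> u"
  shows "\<exists>z\<in>Field r. (\<forall>l\<in>L. (l, z) \<in> r \<and> l \<noteq> z) \<and> (\<forall>u\<in>U. (z, u) \<in> r \<and> z \<noteq> u)"
proof -
  have r': "Linear_order r" "trans r" "antisym r" and ne: "Field r \<noteq> {}"
    and dense: "\<And>x y. (x, y) \<in> r \<Longrightarrow> x \<noteq> y \<Longrightarrow> \<exists>z. (x, z) \<in> r \<and> (z, y) \<in> r \<and> z \<noteq> x \<and> z \<noteq> y"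
    and unb: "\<And>x. x \<in> Field r \<Longrightarrow> \<exists>y. (y, x) \<in> r \<and> y \<noteq> x" "\<And>x. x \<in> Field r \<Longrightarrow> \<exists>y. (x, y) \<in> r \<and> y \<noteq> x"
    using r by (auto simp: dense_unbounded_def order_dense_def order_on_defs)
  have above: "\<forall>l\<in>L. (l, z) \<in> r \<and> l \<noteq> z"
    if "m \<in> L" "\<forall>l\<in>L. (l, m) \<in> r" "(m, z) \<in> r" "m \<noteq> z" for m z
  proof (intro ballI conjI)
    fix l assume "l \<in> L"
    with that(2) have lm: "(l, m) \<in> r" by blast
    with that(3) r'(2) show "(l, z) \<in> r" by (auto dest: transD)
    show "l \<noteq> z" using that(3,4) lm r'(3) by (auto dest: antisymD)
  qed
  have below: "\<forall>u\<in>U. (z, u) \<in> r \<and> z \<noteq> u"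
    if "m \<in> U" "\<forall>u\<in>U. (m, u) \<in> r" "(z, m) \<in> r" "m \<noteq> z" for m z
  proof (intro ballI conjI)
    fix u assume "u \<in> U"
    with that(2) have mu: "(m, u) \<in> r" by blast
    with that(3) r'(2) show "(z, u) \<in> r" by (auto dest: transD)
    show "z \<noteq> u" using that(3,4) mu r'(3) by (auto dest: antisymD)
  qed
  have maxL: "\<exists>m\<in>L. \<forall>l\<in>L. (l, m) \<in> r" if "L \<noteq> {}"
    using finite_linear_max[OF fin(1) that sub(1) r'(1)] .
  have minU: "\<exists>m\<in>U. \<forall>u\<in>U. (m, u) \<in> r" if "U \<noteq> {}"
    using finite_linear_max[of U "r\<inverse>"] fin(2) that sub(2) r'(1) by simp
  consider "L = {}" "U = {}" | "L \<noteq> {}" "U = {}" | "L = {}" "U \<noteq> {}" | "L \<noteq> {}" "U \<noteq> {}" by blast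
  then show ?thesis
  proof cases
    case 1
    with ne show ?thesis by blast
  next
    case 2
    with maxL obtain m where m: "m \<in> L" "\<forall>l\<in>L. (l, m) \<in> r" by blast
    with sub unb(2)[of m] obtain z where "(m, z) \<in> r" "m \<noteq> z" by blast
    with above[OF m] 2 show ?thesis by (auto intro: FieldI2)
  next
    case 3
    with minU obtain m where m: "m \<in> U" "\<forall>u\<in>U. (m, u) \<in> r" by blast
    with sub unb(1)[of m] obtain z where "(z, m) \<in> r" "m \<noteq> z" by blast
    with below[OF m] 3 show ?thesis by (auto intro: FieldI1)
  next
    case 4
    with maxL obtain m where m: "m \<in> L" "\<forall>l\<in>L. (l, m) \<in> r" by blast
    from 4 minU obtain n where n: "n \<in> U" "\<forall>u\<in>U. (n, u) \<in> r" by blast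
    from less[OF m(1) n(1)] dense obtain z where z: "(m, z) \<in> r" "(z, n) \<in> r" "z \<noteq> m" "z \<noteq> n" by blast
    with above[OF m, of z] below[OF n, of z] show ?thesis by (auto intro: FieldI1)
  qed
qed

text \<open>Between linear orders the equivalence makes \<open>p\<close> single-valued and
  injective. Its symmetric form lets the back step be the forth step for the converse.\<close>

definition partial_iso :: "'a rel \<Rightarrow> 'b rel \<Rightarrow> ('a \<times> 'b) set \<Rightarrow> bool" where
  "partial_iso r s p \<longleftrightarrow> finite p \<and> p \<subseteq> Field r \<times> Field s \<and>
    (\<forall>a b c d. (a, b) \<in> p \<longrightarrow> (c, d) \<in> p \<longrightarrow> ((a, c) \<in> r \<longleftrightarrow> (b, d) \<in> s))"

lemma partial_iso_converse: "partial_iso s r (p\<inverse>) \<longleftrightarrow> partial_iso r s p"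
  by (auto simp: partial_iso_def)

lemma partial_iso_extend:
  assumes p: "partial_iso r s p" and r: "Linear_order r" and s: "dense_unbounded s"
    and a: "a \<in> Field r"
  shows "\<exists>b. partial_iso r s (insert (a, b) p)"
proof (cases "a \<in> Domain p")
  case True
  then obtain b where "(a, b) \<in> p" by blast
  with p show ?thesis by (metis insert_absorb)
next
  case False
  have r': "antisym r" "trans r" "refl_on (Field r) r" using r by (simp_all add: order_on_defs)
  have s': "antisym s" "refl_on (Field s) s"
    using s by (simp_all add: order_on_defs dense_unbounded_def)
  have fin: "finite p" and sub: "\<And>c d. (c, d) \<in> p \<Longrightarrow> c \<in> Field r \<and> d \<in> Field s"
    and iff: "\<And>c d e f. (c, d) \<in> p \<Longrightarrow> (e, f) \<in> p \<Longrightarrow> (c, e) \<in> r \<longleftrightarrow> (d, f) \<in> s"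
    using p unfolding partial_iso_def by blast+
  \<comment> \<open>The images of the points below and above \<open>a\<close>; the image of
    \<open>a\<close> has to be put strictly between them.\<close>
  define L where "L = snd ` {q \<in> p. (fst q, a) \<in> r}"
  define U where "U = snd ` {q \<in> p. (a, fst q) \<in> r}"
  have "\<exists>z\<in>Field s. (\<forall>l\<in>L. (l, z) \<in> s \<and> l \<noteq> z) \<and> (\<forall>u\<in>U. (z, u) \<in> s \<and> z \<noteq> u)"
  proof (rule dense_unbounded_between[OF s])
    show "finite L" "finite U" using fin by (simp_all add: L_def U_def)
    show "L \<subseteq> Field s" "U \<subseteq> Field s" using sub by (auto simp: L_def U_def)
    fix l u assume "l \<in> L" "u \<in> U"
    then obtain c d where c: "(c, l) \<in> p" "(c, a) \<in> r" and d: "(d, u) \<in> p" "(a, d) \<in> r"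
      by (auto simp: L_def U_def)
    then have "(c, d) \<in> r" using r'(2) by (auto dest: transD)
    with iff c d have "(l, u) \<in> s" by blast
    moreover have "l \<noteq> u"
    proof
      assume "l = u"
      with c d iff[OF d(1) c(1)] sub s'(2) have "(d, c) \<in> r" by (auto simp: refl_on_def)
      with \<open>(c, d) \<in> r\<close> r'(1) have "c = d" by (auto dest: antisymD)
      with c d r'(1) have "c = a" by (auto dest: antisymD)
      with c False show False by blast
    qed
    ultimately show "(l, u) \<in> s \<and> l \<noteq> u" ..
  qed
  then obtain z where z: "z \<in> Field s" "\<And>l. l \<in> L \<Longrightarrow> (l, z) \<in> s \<and> l \<noteq> z"
    "\<And>u. u \<in> U \<Longrightarrow> (z, u) \<in> s \<and> z \<noteq> u" by blast
  have LU: "(d, z) \<in> s \<and> d \<noteq> z \<and> (z, d) \<notin> s" if "(c, d) \<in> p" "(c, a) \<in> r" for c d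
  proof -
    from that have "d \<in> L" by (force simp: L_def)
    with z(2)[of d] s'(1) show ?thesis by (auto dest: antisymD)
  qed
  have UL: "(z, d) \<in> s \<and> d \<noteq> z \<and> (d, z) \<notin> s" if "(c, d) \<in> p" "(a, c) \<in> r" for c d
  proof -
    from that have "d \<in> U" by (force simp: U_def)
    with z(3)[of d] s'(1) show ?thesis by (auto dest: antisymD)
  qed
  have "(a, c) \<in> r \<longleftrightarrow> (z, d) \<in> s" "(c, a) \<in> r \<longleftrightarrow> (d, z) \<in> s" if "(c, d) \<in> p" for c d
    using Linear_order_cases[OF r a, of c] sub[OF that] LU[OF that] UL[OF that] by blast+
  moreover have "(a, a) \<in> r" "(z, z) \<in> s" using a z(1) r'(3) s'(2) by (auto simp: refl_on_def)
  ultimately have "partial_iso r s (insert (a, z) p)"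
    using fin sub iff a z(1) unfolding partial_iso_def by auto
  then show ?thesis ..
qed

text \<open>Back-and-forth: each stage adds the next point of both enumerations, and the union of
  the stages is the graph of the isomorphism.\<close>

theorem Cantor_order_isomorphic:
  assumes r: "dense_unbounded r" "countable (Field r)" and s: "dense_unbounded s" "countable (Field s)"
  shows "order_isomorphic r s"
proof -
  define ea where "ea = from_nat_into (Field r)"
  define eb where "eb = from_nat_into (Field s)"
  have ne: "Field r \<noteq> {}" "Field s \<noteq> {}" and lin: "Linear_order r" "Linear_order s"
    using r s by (simp_all add: dense_unbounded_def)
  have ea: "range ea = Field r" and eb: "range eb = Field s"
    using ne r s by (simp_all add: ea_def eb_def)
  have "\<exists>P. \<forall>n. partial_iso r s (P n) \<and>
      (P n \<subseteq> P (Suc n) \<and> ea n \<in> Domain (P (Suc n)) \<and> eb n \<in> Range (P (Suc n)))"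
  proof (rule dependent_nat_choice)
    show "\<exists>p. partial_iso r s p"
      by (intro exI[of _ "{}"]) (simp add: partial_iso_def)
    fix p and n :: nat
    assume p: "partial_iso r s p"
    from partial_iso_extend[OF p lin(1) s(1), of "ea n"] ea
    obtain b where "partial_iso r s (insert (ea n, b) p)" by blast
    then have "partial_iso s r ((insert (ea n, b) p)\<inverse>)" by (simp only: partial_iso_converse)
    from partial_iso_extend[OF this lin(2) r(1), of "eb n"] eb
    obtain a where "partial_iso s r (insert (eb n, a) ((insert (ea n, b) p)\<inverse>))" by blast
    also have "insert (eb n, a) ((insert (ea n, b) p)\<inverse>) = (insert (a, eb n) (insert (ea n, b) p))\<inverse>"
      by auto
    finally have "partial_iso r s (insert (a, eb n) (insert (ea n, b) p))"
      by (simp only: partial_iso_converse)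
    then show "\<exists>p'. partial_iso r s p' \<and> (p \<subseteq> p' \<and> ea n \<in> Domain p' \<and> eb n \<in> Range p')"
      by blast
  qed
  then obtain P where P: "\<And>n. partial_iso r s (P n)" "\<And>n. P n \<subseteq> P (Suc n)"
    "\<And>n. ea n \<in> Domain (P (Suc n))" "\<And>n. eb n \<in> Range (P (Suc n))" by blast
  define G where "G = (\<Union>n. P n)"
  have mono: "P m \<subseteq> P n" if "m \<le> n" for m n
    using lift_Suc_mono_le[of P m n] P(2) that by blast
  have iff: "(a, c) \<in> r \<longleftrightarrow> (b, d) \<in> s" if "(a, b) \<in> G" "(c, d) \<in> G" for a b c d
  proof -
    from that obtain m n where "(a, b) \<in> P m" "(c, d) \<in> P n" by (auto simp: G_def)
    with mono[of m "max m n"] mono[of n "max m n"] have "(a, b) \<in> P (max m n)" "(c, d) \<in> P (max m n)"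
      by auto
    with P(1)[of "max m n"] show ?thesis unfolding partial_iso_def by blast
  qed
  have sub: "a \<in> Field r" "b \<in> Field s" if "(a, b) \<in> G" for a b
    using that P(1) unfolding G_def partial_iso_def by blast+
  have r': "antisym r" "refl_on (Field r) r" and s': "antisym s" "refl_on (Field s) s"
    using lin by (simp_all add: order_on_defs)
  have eq: "a = c \<longleftrightarrow> b = d" if "(a, b) \<in> G" "(c, d) \<in> G" for a b c d
    using iff[OF that] iff[OF that(2,1)] iff[OF that(1,1)] sub[OF that(1)] sub[OF that(2)] r' s'
    unfolding refl_on_def by (metis antisymD)
  have "\<exists>b. (a, b) \<in> G" if "a \<in> Field r" for a
  proof -
    from that ea obtain n where "a = ea n" by blast
    with P(3)[of n] show ?thesis by (auto simp: G_def)
  qed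
  then obtain h where h: "\<And>a. a \<in> Field r \<Longrightarrow> (a, h a) \<in> G" by metis
  have "bij_betw h (Field r) (Field s)"
    unfolding bij_betw_def
  proof
    show "inj_on h (Field r)" using h eq by (metis inj_onI)
    show "h ` Field r = Field s"
    proof
      show "h ` Field r \<subseteq> Field s" using h sub by blast
      show "Field s \<subseteq> h ` Field r"
      proof
        fix b assume "b \<in> Field s"
        with eb obtain n where "b = eb n" by blast
        with P(4)[of n] obtain a where "(a, b) \<in> G" by (auto simp: G_def)
        with h[of a] eq sub show "b \<in> h ` Field r" by blast
      qed
    qed
  qed
  with h iff show ?thesis unfolding order_isomorphic_def by blast
qed

section \<open>The rationals, dense powers and the splitting of Z^r\<close>

lemma Field_rat_order: "Field rat_order = UNIV"
  by (auto simp: rat_order_def Field_def)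

lemma Linear_order_rat_order: "Linear_order rat_order"
  unfolding order_on_defs Field_rat_order
  by (auto simp: rat_order_def refl_on_def trans_def antisym_def total_on_def)

lemma order_dense_rat_order: "order_dense rat_order"
  unfolding order_dense_def rat_order_def
proof (intro allI impI)
  fix x y :: rat
  assume "(x, y) \<in> {(a, b). a \<le> b}" "x \<noteq> y"
  then have "x < y" by simp
  then obtain z where "x < z" "z < y" using dense by blast
  then show "\<exists>z. (x, z) \<in> {(a, b). a \<le> b} \<and> (z, y) \<in> {(a, b). a \<le> b} \<and> z \<noteq> x \<and> z \<noteq> y"
    by (intro exI[of _ z]) auto
qed

lemma dense_unbounded_rat_order: "dense_unbounded rat_order"
proof -
  have "\<exists>y. (y, x) \<in> rat_order \<and> y \<noteq> x" "\<exists>y. (x, y) \<in> rat_order \<and> y \<noteq> x" for x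
    by (rule exI[of _ "x - 1"], simp add: rat_order_def)
      (rule exI[of _ "x + 1"], simp add: rat_order_def)
  then show ?thesis
    using Linear_order_rat_order order_dense_rat_order
    by (simp add: dense_unbounded_def Field_rat_order)
qed

text \<open>Below the greatest difference \<open>t\<close> of \<open>f\<close> and \<open>g\<close>
  there is a further \<open>x\<close>. Raising the smaller function at \<open>x\<close> stays below
  the larger one, since \<open>t\<close> still decides. Changing one value by 1 excludes
  endpoints.\<close>

lemma dense_unbounded_Z_pow:
  assumes r: "Linear_order r" and ne: "Field r \<noteq> {}"
    and no_min: "\<And>x. x \<in> Field r \<Longrightarrow> \<exists>y. (y, x) \<in> r \<and> y \<noteq> x"
  shows "dense_unbounded (Z_pow r)"
  unfolding dense_unbounded_def Field_Z_pow
proof (intro conjI ballI)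
  show "linear_order_on (fin_supp r) (Z_pow r)"
    using Linear_order_Z_pow[OF r] by (simp add: Field_Z_pow)
  show "fin_supp r \<noteq> {}" using fin_supp_0 by blast
  from ne obtain x where x: "x \<in> Field r" by blast
  then have xx: "(x, x) \<in> r" using r by (auto simp: order_on_defs refl_on_def)
  fix f assume f: "f \<in> fin_supp r"
  have "(f(x := f x - 1), f) \<in> Z_pow r" "(f, f(x := f x + 1)) \<in> Z_pow r"
    using f x xx by (auto intro!: Z_powI[where x = x] fin_supp_upd split: if_splits)
  moreover have "f(x := f x - 1) \<noteq> f" "f(x := f x + 1) \<noteq> f"
    by (auto dest: fun_cong[of _ _ x])
  ultimately show "\<exists>g. (g, f) \<in> Z_pow r \<and> g \<noteq> f" "\<exists>g. (f, g) \<in> Z_pow r \<and> g \<noteq> f"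
    by blast+
next
  show "order_dense (Z_pow r)"
    unfolding order_dense_def
  proof (intro allI impI)
    fix f g assume fg: "(f, g) \<in> Z_pow r" and ne: "f \<noteq> g"
    then obtain t where t: "f t < g t" "\<And>y. f y \<noteq> g y \<Longrightarrow> (y, t) \<in> r" by (rule Z_powE) blast
    from t have "(t, t) \<in> r" by simp
    then have "t \<in> Field r" by (rule FieldI1)
    with no_min obtain x where x: "(x, t) \<in> r" "x \<noteq> t" by blast
    have xF: "x \<in> Field r" using x(1) by (rule FieldI1)
    have fs: "f \<in> fin_supp r" "g \<in> fin_supp r" using fg by (auto dest: Z_pow_D)
    let ?k = "f(x := f x + 1)"
    have k: "?k \<in> fin_supp r" using fs xF by (intro fin_supp_upd)
    have "(f, ?k) \<in> Z_pow r" by (rule Z_pow_upd[OF r fs(1) xF]) simp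
    moreover have "(?k, g) \<in> Z_pow r"
      using t x fs k by (intro Z_powI[where x = t]) (auto split: if_splits)
    moreover have "?k \<noteq> f" by (auto dest: fun_cong[of _ _ x])
    moreover have "?k \<noteq> g" using t(1) x(2) by (metis fun_upd_other less_irrefl)
    ultimately show "\<exists>k. (f, k) \<in> Z_pow r \<and> (k, g) \<in> Z_pow r \<and> k \<noteq> f \<and> k \<noteq> g" by blast
  qed
qed

lemma countable_fin_supp: "countable (fin_supp (r :: nat rel))"
proof -
  have "f \<in> range (\<lambda>xs i. if i < length xs then xs ! i else 0)" if f: "f \<in> fin_supp r" for f
  proof -
    from f obtain N where "\<forall>i\<in>{i. f i \<noteq> 0}. i < N"
      unfolding fin_supp_def finite_nat_set_iff_bounded by blast
    then have "f = (\<lambda>i. if i < length (map f [0..<N]) then map f [0..<N] ! i else 0)" by fastforce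
    then show ?thesis by (rule range_eqI)
  qed
  then have "fin_supp r \<subseteq> range (\<lambda>(xs :: int list) i. if i < length xs then xs ! i else 0)"
    by blast
  then show ?thesis
    by (rule countable_subset) (rule countable_image, rule countableI_type)
qed

text \<open>Points outside the initial segment \<open>W\<close> lie above those inside, so a
  difference there takes precedence. The part of \<open>f\<close> outside \<open>W\<close> is
  therefore the second, more significant coordinate.\<close>

lemma Z_pow_split:
  assumes r: "Linear_order r" and W: "W \<subseteq> Field r" "\<And>x y. (x, y) \<in> r \<Longrightarrow> y \<in> W \<Longrightarrow> x \<in> W"
  shows "order_isomorphic (Z_pow r) (order_prod (Z_pow (Restr r W)) (Z_pow (Restr r (Field r - W))))"
proof -
  let ?A = "Restr r W" and ?B = "Restr r (Field r - W)"
  have refl: "Refl r" using r by (simp add: order_on_defs)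
  have FA: "Field ?A = W" and FB: "Field ?B = Field r - W"
    using Refl_Field_Restr2[OF refl] W(1) by auto
  have lA: "Linear_order ?A" and lB: "Linear_order ?B" using r by (simp_all add: Linear_order_Restr)
  note LA = Linear_order_Z_pow[OF lA] and LB = Linear_order_Z_pow[OF lB]
  have FP: "Field (order_prod (Z_pow ?A) (Z_pow ?B)) = fin_supp ?A \<times> fin_supp ?B"
    using LA LB by (simp add: Field_order_prod Field_Z_pow order_on_defs)
  define h where "h f = ((\<lambda>x. if x \<in> W then f x else 0), (\<lambda>x. if x \<in> W then 0 else f x))"
    for f :: "'a \<Rightarrow> int"
  have h_in: "h f \<in> fin_supp ?A \<times> fin_supp ?B" if f: "f \<in> fin_supp r" for f
  proof -
    have "{x. (if x \<in> W then f x else 0) \<noteq> 0} \<subseteq> {x. f x \<noteq> 0}"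
      "{x. (if x \<in> W then 0 else f x) \<noteq> 0} \<subseteq> {x. f x \<noteq> 0}" by auto
    from finite_subset[OF this(1)] finite_subset[OF this(2)] f show ?thesis
      unfolding h_def fin_supp_def FA FB by auto
  qed
  show ?thesis
  proof (rule order_isomorphicI)
    show "Linear_order (Z_pow r)" by (rule Linear_order_Z_pow[OF r])
    show "antisym (order_prod (Z_pow ?A) (Z_pow ?B))"
      using Linear_order_order_prod[OF LA LB] by (simp add: order_on_defs)
    show "bij_betw h (Field (Z_pow r)) (Field (order_prod (Z_pow ?A) (Z_pow ?B)))"
      unfolding FP Field_Z_pow
    proof (rule bij_betwI[where g = "\<lambda>(f, g). \<lambda>x. f x + g x"])
      show "h \<in> fin_supp r \<rightarrow> fin_supp ?A \<times> fin_supp ?B" using h_in by blast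
      have "fin_supp ?A \<subseteq> fin_supp r" "fin_supp ?B \<subseteq> fin_supp r"
        using W(1) by (auto simp: fin_supp_def FA FB)
      then show "(\<lambda>(f, g). \<lambda>x. f x + g x) \<in> fin_supp ?A \<times> fin_supp ?B \<rightarrow> fin_supp r"
        by (auto intro: fin_supp_add)
      show "(case h f of (f, g) \<Rightarrow> \<lambda>x. f x + g x) = f" for f
        by (auto simp: h_def)
      fix p assume "p \<in> fin_supp ?A \<times> fin_supp ?B"
      then obtain f g where p: "p = (f, g)" "f \<in> fin_supp ?A" "g \<in> fin_supp ?B" by blast
      then have "x \<notin> W \<Longrightarrow> f x = 0" "x \<in> W \<Longrightarrow> g x = 0" for x
        using fin_suppD[of f ?A x] fin_suppD[of g ?B x] unfolding FA FB by blast+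
      then show "h (case p of (f, g) \<Rightarrow> \<lambda>x. f x + g x) = p"
        by (auto simp: h_def p(1))
    qed
    fix f g assume fg: "(f, g) \<in> Z_pow r"
    then have fs: "h f \<in> fin_supp ?A \<times> fin_supp ?B" "h g \<in> fin_supp ?A \<times> fin_supp ?B"
      using h_in by (auto dest: Z_pow_D)
    show "(h f, h g) \<in> order_prod (Z_pow ?A) (Z_pow ?B)"
    proof (cases "f = g")
      case True
      with fs show ?thesis
        using Linear_order_order_prod[OF LA LB] FP by (auto simp: order_on_defs refl_on_def)
    next
      case False
      with fg obtain t where t: "f t < g t" "\<And>y. f y \<noteq> g y \<Longrightarrow> (y, t) \<in> r" by (rule Z_powE) blast
      from t have "(t, t) \<in> r" by simp
      then have tF: "t \<in> Field r" by (rule FieldI1)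
      show ?thesis
      proof (cases "t \<in> W")
        case True
        then have "y \<in> W" if "f y \<noteq> g y" for y using t(2) that W(2) by blast
        then have snd: "snd (h f) = snd (h g)" by (fastforce simp: h_def)
        have "(fst (h f), fst (h g)) \<in> Z_pow ?A"
          using fs True t W(2) by (intro Z_powI[where x = t]) (auto simp: h_def split: if_splits)
        with fs snd show ?thesis
          by (simp add: h_def order_prod_iff Field_Z_pow)
      next
        case False
        have "(snd (h f), snd (h g)) \<in> Z_pow ?B"
          using fs False t tF by (intro Z_powI[where x = t]) (auto simp: h_def intro: FieldI1 split: if_splits)
        moreover have "snd (h f) \<noteq> snd (h g)"
          using t(1) False by (auto simp: h_def dest: fun_cong[of _ _ t])
        ultimately show ?thesis using fs
          by (simp add: h_def order_prod_iff Field_Z_pow)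
      qed
    qed
  qed
qed

text \<open>Outside the well-founded part \<open>W\<close>, the order is empty or has no least
  element. In the second case the power of this remainder is countable, dense and without endpoints,
  hence a copy of the rationals, and \<epsilon> is 1.\<close>

lemma has_type_ZQ_Z_pow:
  fixes r :: "nat rel"
  assumes r: "Linear_order r"
  shows "\<exists>\<alpha> :: nat rel. \<exists>\<epsilon>\<in>{0, 1}. Well_order \<alpha> \<and> has_type_ZQ (Z_pow r) \<alpha> \<epsilon>"
proof -
  define W where "W = Field r \<inter> Wellfounded.acc (r - Id)"
  have W: "W \<subseteq> Field r" "\<And>x y. (x, y) \<in> r \<Longrightarrow> y \<in> W \<Longrightarrow> x \<in> W"
    using acc_downward[of _ "r - Id"] by (auto simp: W_def intro: FieldI1)
  let ?A = "Restr r W" and ?B = "Restr r (Field r - W)"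
  have refl: "Refl r" using r by (simp add: order_on_defs)
  have FB: "Field ?B = Field r - W"
    using Refl_Field_Restr2[OF refl] W(1) by auto
  have "wf (?A - Id)"
  proof (rule wfI_min)
    fix x :: nat and Q assume "x \<in> Q"
    show "\<exists>m\<in>Q. \<forall>y. (y, m) \<in> ?A - Id \<longrightarrow> y \<notin> Q"
    proof (cases "Q \<inter> W = {}")
      case False
      then obtain w where w: "w \<in> Q" "w \<in> W" by blast
      then have "w \<in> Wellfounded.acc (r - Id)" by (simp add: W_def)
      then have "w \<in> Q \<longrightarrow> w \<in> W \<longrightarrow> (\<exists>m\<in>Q. \<forall>y. (y, m) \<in> ?A - Id \<longrightarrow> y \<notin> Q)"
        by (rule acc_induct) blast
      with w show ?thesis by blast
    qed (use \<open>x \<in> Q\<close> in auto)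
  qed
  with r have A: "Well_order ?A" by (simp add: well_order_on_def Linear_order_Restr)
  show ?thesis
  proof (cases "Field r = W")
    case True
    then have "?A = r" by (auto intro: FieldI1 FieldI2)
    with A show ?thesis
      by (intro exI[of _ ?A] bexI[of _ 0]) (auto simp: has_type_ZQ_def order_isomorphic_refl)
  next
    case False
    have lB: "Linear_order ?B" using r by (simp add: Linear_order_Restr)
    \<comment> \<open>If all points strictly below \<open>x\<close> were accessible,
      \<open>x\<close> would be accessible too; so some point below \<open>x\<close> is again
      outside \<open>W\<close>.\<close>
    have "\<exists>y. (y, x) \<in> ?B \<and> y \<noteq> x" if "x \<in> Field ?B" for x
    proof -
      from that have x: "x \<in> Field r" "x \<notin> Wellfounded.acc (r - Id)" unfolding FB by (auto simp: W_def)
      then obtain y where "(y, x) \<in> r - Id" "y \<notin> Wellfounded.acc (r - Id)" by (metis accI)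
      with that show ?thesis unfolding FB by (auto simp: W_def intro: FieldI1)
    qed
    then have "dense_unbounded (Z_pow ?B)"
      using lB False W(1) by (intro dense_unbounded_Z_pow) (auto simp: FB)
    then have "order_isomorphic (Z_pow ?B) rat_order"
      by (intro Cantor_order_isomorphic dense_unbounded_rat_order)
        (auto simp: Field_Z_pow countable_fin_supp)
    moreover have "Linear_order (Z_pow ?A)" "Linear_order (Z_pow ?B)"
      using r by (simp_all add: Linear_order_Z_pow Linear_order_Restr)
    ultimately have
      "order_isomorphic (order_prod (Z_pow ?A) (Z_pow ?B)) (order_prod (Z_pow ?A) rat_order)"
      using Linear_order_rat_order by (intro order_prod_cong) (simp_all add: order_on_defs)
    with Z_pow_split[OF r W] have "order_isomorphic (Z_pow r) (order_prod (Z_pow ?A) rat_order)"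
      by (rule order_isomorphic_trans)
    with A show ?thesis
      by (intro exI[of _ ?A] bexI[of _ 1]) (auto simp: has_type_ZQ_def)
  qed
qed


section \<open>Closed relations and Kleene-Brouwer orders\<close>

text \<open>The neighbourhood filter of \<open>z\<close> in a product of discrete spaces. With
  \<open>eventually\<close>, finitely many moduli of continuity combine without explicit
  maxima.\<close>

definition cylinders :: "(nat \<Rightarrow> 'a) \<Rightarrow> (nat \<Rightarrow> 'a) filter" where
  "cylinders z = (INF N. principal {z'. \<forall>i<N. z' i = z i})"

lemma eventually_cylinders:
  "eventually P (cylinders z) \<longleftrightarrow> (\<exists>N. \<forall>z'. (\<forall>i<N. z' i = z i) \<longrightarrow> P z')"
  unfolding cylinders_def
proof (subst eventually_INF_base)
  fix M N :: nat
  show "\<exists>K\<in>UNIV. principal {z'. \<forall>i<K. z' i = z i}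
      \<le> inf (principal {z'. \<forall>i<M. z' i = z i}) (principal {z'. \<forall>i<N. z' i = z i})"
    by (intro bexI[of _ "max M N"]) auto
qed (auto simp: eventually_principal)

lemma eventually_cylinders_nth: "\<forall>\<^sub>F z' in cylinders z. z' i = z i"
  unfolding eventually_cylinders by (intro exI[of _ "Suc i"]) simp

text \<open>A halting computation consults its oracle at finitely many places, hence takes the same
  course for all oracles that share a long enough initial segment.\<close>

lemma oeval_use: "oeval p c xs v \<Longrightarrow> \<forall>\<^sub>F p' in cylinders p. oeval p' c xs v"
proof (induction rule: oeval.induct)
  case (orac x)
  show ?case
    using eventually_cylinders_nth[of x p] by eventually_elim (metis oeval.orac)
next
  case (comp xs gs ys f v)
  have len: "length gs = length ys"
    using comp.IH(1) by (rule list_all2_lengthD)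
  have "\<forall>\<^sub>F p' in cylinders p. \<forall>i\<in>{..<length gs}. oeval p' (gs ! i) xs (ys ! i)"
    using comp.IH(1) by (intro eventually_ball_finite) (auto simp: list_all2_conv_all_nth)
  with comp.IH(2) show ?case
    by eventually_elim (auto intro!: oeval.comp simp: list_all2_conv_all_nth len)
next
  case (prec_0 f xs v g)
  then show ?case by (auto elim: eventually_mono intro: oeval.prec_0)
next
  case (prec_Suc f g n xs u v)
  from prec_Suc.IH show ?case by eventually_elim (rule oeval.prec_Suc)
next
  case (min f n xs)
  then have "\<forall>\<^sub>F p' in cylinders p. \<forall>m\<in>{..<n}. \<exists>k. oeval p' f (m # xs) (Suc k)"
    by (intro eventually_ball_finite) (blast intro: eventually_mono | simp)+
  with min.IH(1) show ?case
    by eventually_elim (auto intro: oeval.min)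
qed (auto intro!: always_eventually oeval.intros)

text \<open>For fixed \<open>N\<close> this depends only on \<open>p\<close> below \<open>N\<close>
  and is a clopen condition on \<open>p\<close>, while halting as such is only open.\<close>

definition forces :: "baire \<Rightarrow> nat \<Rightarrow> oprog \<Rightarrow> nat list \<Rightarrow> nat \<Rightarrow> bool" where
  "forces p N c xs v \<longleftrightarrow> (\<forall>p'. (\<forall>i<N. p' i = p i) \<longrightarrow> oeval p' c xs v)"

lemma forces_imp_oeval: "forces p N c xs v \<Longrightarrow> oeval p c xs v"
  by (simp add: forces_def)

lemma oeval_imp_forces: "oeval p c xs v \<Longrightarrow> \<exists>N. forces p N c xs v"
  using oeval_use[of p c xs v] by (simp add: forces_def eventually_cylinders)

text \<open>Continuity into a discrete space; for truth values, clopenness.\<close>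

definition locally_constant :: "((nat \<Rightarrow> 'a) \<Rightarrow> 'b) \<Rightarrow> bool" where
  "locally_constant F \<longleftrightarrow> (\<forall>z. \<forall>\<^sub>F z' in cylinders z. F z' = F z)"

lemma locally_constant_const: "locally_constant (\<lambda>z. a)"
  by (simp add: locally_constant_def)

lemma locally_constant_nth: "locally_constant (\<lambda>z. z i)"
  by (simp add: locally_constant_def eventually_cylinders_nth)

lemma locally_constant_comp: "locally_constant F \<Longrightarrow> locally_constant (\<lambda>z. g (F z))"
  unfolding locally_constant_def
proof
  fix z
  assume "\<forall>z. \<forall>\<^sub>F z' in cylinders z. F z' = F z"
  then have "\<forall>\<^sub>F z' in cylinders z. F z' = F z" ..
  then show "\<forall>\<^sub>F z' in cylinders z. g (F z') = g (F z)"
    by eventually_elim simp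
qed

lemma locally_constant_comp2:
  assumes "locally_constant F" "locally_constant G"
  shows "locally_constant (\<lambda>z. g (F z) (G z))"
  unfolding locally_constant_def
proof
  fix z
  from assms have "\<forall>\<^sub>F z' in cylinders z. F z' = F z" "\<forall>\<^sub>F z' in cylinders z. G z' = G z"
    by (simp_all add: locally_constant_def)
  then show "\<forall>\<^sub>F z' in cylinders z. g (F z') (G z') = g (F z) (G z)"
    by eventually_elim simp
qed

text \<open>For reading \<open>z\<close> at a position that itself depends on \<open>z\<close>, as
  happens in \<open>diag_tree\<close>.\<close>

lemma locally_constant_index:
  assumes "locally_constant N" "\<And>i. locally_constant (F i)"
  shows "locally_constant (\<lambda>z. F (N z) z)"
  unfolding locally_constant_def
proof
  fix z
  have "\<forall>\<^sub>F z' in cylinders z. N z' = N z" "\<forall>\<^sub>F z' in cylinders z. F (N z) z' = F (N z) z"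
    using assms by (simp_all add: locally_constant_def)
  then show "\<forall>\<^sub>F z' in cylinders z. F (N z') z' = F (N z) z"
    by eventually_elim simp
qed

lemma locally_constant_Ball:
  assumes "finite D" "\<And>d. d \<in> D \<Longrightarrow> locally_constant (P d)"
  shows "locally_constant (\<lambda>z. \<forall>d\<in>D. P d z)"
  unfolding locally_constant_def
proof
  fix z
  have "\<forall>\<^sub>F z' in cylinders z. \<forall>d\<in>D. P d z' = P d z"
    using assms by (intro eventually_ball_finite) (auto simp: locally_constant_def)
  then show "\<forall>\<^sub>F z' in cylinders z. (\<forall>d\<in>D. P d z') = (\<forall>d\<in>D. P d z)"
    by eventually_elim simp
qed

lemma locally_constant_Bex:
  assumes "finite D" "\<And>d. d \<in> D \<Longrightarrow> locally_constant (P d)"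
  shows "locally_constant (\<lambda>z. \<exists>d\<in>D. P d z)"
  using locally_constant_comp[OF locally_constant_Ball[OF assms(1), of "\<lambda>d z. \<not> P d z"], of Not]
    locally_constant_comp[OF assms(2), of _ Not] by simp

lemma locally_constant_map:
  assumes "\<And>i. locally_constant (F i)"
  shows "locally_constant (\<lambda>z. map (\<lambda>i. F i z) xs)"
proof (induction xs)
  case (Cons a xs)
  from locally_constant_comp2[OF assms[of a] Cons, of "(#)"] show ?case by simp
qed (simp add: locally_constant_const)

text \<open>Near \<open>z\<close> the bound \<open>N z\<close> is constant, and only the finitely
  many entries of \<open>P z\<close> below it enter into \<open>forces\<close>.\<close>

lemma locally_constant_forces:
  assumes "locally_constant N" "\<And>i. locally_constant (\<lambda>z. P z i)" "locally_constant A"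
  shows "locally_constant (\<lambda>z. forces (P z) (N z) c (A z) v)"
  unfolding locally_constant_def
proof
  fix z
  have "\<forall>\<^sub>F z' in cylinders z. \<forall>i\<in>{..<N z}. P z' i = P z i"
    using assms by (intro eventually_ball_finite) (auto simp: locally_constant_def)
  moreover have "\<forall>\<^sub>F z' in cylinders z. N z' = N z" "\<forall>\<^sub>F z' in cylinders z. A z' = A z"
    using assms by (simp_all add: locally_constant_def)
  ultimately show "\<forall>\<^sub>F z' in cylinders z. forces (P z') (N z') c (A z') v = forces (P z) (N z) c (A z) v"
    by eventually_elim (simp add: forces_def)
qed

section \<open>Diagonalisation over closed relations\<close>

text \<open>The section at \<open>x\<close> of the closed relation coded by \<open>x\<close> itself.\<close>

definition diag_tree :: "baire \<Rightarrow> nat list set" where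
  "diag_tree x =
    {\<sigma>. \<forall>k\<le>length \<sigma>. x (list_encode (map (\<lambda>i. prod_encode (x i, \<sigma> ! i)) [0..<k])) = 1}"

lemma is_tree_diag_tree: "is_tree (diag_tree x)"
proof -
  have "\<tau> \<in> diag_tree x" if "\<tau> @ \<rho> \<in> diag_tree x" for \<tau> \<rho>
    unfolding diag_tree_def
  proof safe
    fix k assume k: "k \<le> length \<tau>"
    with that have "x (list_encode (map (\<lambda>i. prod_encode (x i, (\<tau> @ \<rho>) ! i)) [0..<k])) = 1"
      by (simp add: diag_tree_def)
    moreover have "map (\<lambda>i. prod_encode (x i, (\<tau> @ \<rho>) ! i)) [0..<k]
        = map (\<lambda>i. prod_encode (x i, \<tau> ! i)) [0..<k]"
      using k by (simp add: nth_append)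
    ultimately show "x (list_encode (map (\<lambda>i. prod_encode (x i, \<tau> ! i)) [0..<k])) = 1"
      by metis
  qed
  then show ?thesis unfolding is_tree_def by (metis prefixE)
qed

lemma is_path_diag_tree:
  "is_path (diag_tree x) f \<longleftrightarrow>
    (\<forall>k. x (list_encode (map (\<lambda>i. prod_encode (x i, f i)) [0..<k])) = 1)"
proof -
  have "map f [0..<n] \<in> diag_tree x \<longleftrightarrow>
      (\<forall>k\<le>n. x (list_encode (map (\<lambda>i. prod_encode (x i, f i)) [0..<k])) = 1)" for n
  proof -
    have "map (\<lambda>i. prod_encode (x i, map f [0..<n] ! i)) [0..<k]
        = map (\<lambda>i. prod_encode (x i, f i)) [0..<k]" if "k \<le> n" for k
      using that by simp
    then have "(\<forall>k\<le>n. x (list_encode (map (\<lambda>i. prod_encode (x i, map f [0..<n] ! i)) [0..<k])) = 1)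
        \<longleftrightarrow> (\<forall>k\<le>n. x (list_encode (map (\<lambda>i. prod_encode (x i, f i)) [0..<k])) = 1)"
      by (intro all_cong) (simp only:)
    then show ?thesis by (simp only: diag_tree_def mem_Collect_eq length_map length_upt diff_zero)
  qed
  then show ?thesis
    unfolding is_path_def by blast
qed

lemma locally_constant_diag_tree:
  "locally_constant (\<lambda>z. \<sigma> \<in> diag_tree (\<lambda>i. fst (z i :: nat \<times> nat)))"
proof -
  define K where "K k z = list_encode (map (\<lambda>i. prod_encode (fst (z i), \<sigma> ! i)) [0..<k])"
    for k and z :: "nat \<Rightarrow> nat \<times> nat"
  have "locally_constant (K k)" for k
    unfolding K_def
    by (intro locally_constant_comp[where g = list_encode] locally_constant_map
      locally_constant_comp[OF locally_constant_nth, of "\<lambda>a. prod_encode (fst a, \<sigma> ! i)" i for i])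
  then have "locally_constant (\<lambda>z. z (K k z))" for k
    by (rule locally_constant_index[where F = "\<lambda>i z. z i"]) (rule locally_constant_nth)
  then have "locally_constant (\<lambda>z. fst (z (K k z)) = 1)" for k
    by (rule locally_constant_comp[where g = "\<lambda>a. fst a = 1"])
  then have "locally_constant (\<lambda>z. \<forall>k\<in>{..length \<sigma>}. fst (z (K k z)) = 1)"
    by (intro locally_constant_Ball) auto
  then show ?thesis by (simp add: diag_tree_def K_def Ball_def)
qed

text \<open>An intersection of clopen sets is closed, so a point belongs to it iff each of its
  initial segments extends to a member. Hence the indicator function of the codes of extendible
  segments can serve as \<open>x\<close>.\<close>

lemma diagonal_closed:
  fixes C :: "'i \<Rightarrow> (nat \<Rightarrow> nat \<times> nat) \<Rightarrow> bool"
  assumes "\<And>i. locally_constant (C i)"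
  shows "\<exists>x. \<forall>f. is_path (diag_tree x) f \<longleftrightarrow> (\<forall>i. C i (\<lambda>k. (x k, f k)))"
proof -
  define code where "code z k = list_encode (map (\<lambda>i. prod_encode (z i)) [0..<k])"
    for z :: "nat \<Rightarrow> nat \<times> nat" and k
  define x :: baire where "x s = of_bool (\<exists>z k. s = code z k \<and> (\<forall>i. C i z))" for s
  have "is_path (diag_tree x) f \<longleftrightarrow> (\<forall>i. C i (\<lambda>k. (x k, f k)))" for f
  proof -
    define z where "z k = (x k, f k)" for k
    have "is_path (diag_tree x) f \<longleftrightarrow> (\<forall>k. \<exists>z' k'. code z k = code z' k' \<and> (\<forall>i. C i z'))"
      unfolding is_path_diag_tree x_def[of "list_encode _"] by (simp add: code_def z_def)
    also have "\<dots> \<longleftrightarrow> (\<forall>i. C i z)"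
    proof (intro iffI allI)
      fix i
      assume *: "\<forall>k. \<exists>z' k'. code z k = code z' k' \<and> (\<forall>i. C i z')"
      \<comment> \<open>Closedness: \<open>C i\<close> at \<open>z\<close> is decided by the first
        \<open>N\<close> entries, and this segment of \<open>z\<close> is also that of a member
        \<open>z'\<close>.\<close>
      from assms[of i] have "\<forall>\<^sub>F z' in cylinders z. C i z' = C i z"
        by (simp add: locally_constant_def)
      then obtain N where N: "\<And>z'. (\<And>j. j < N \<Longrightarrow> z' j = z j) \<Longrightarrow> C i z' = C i z"
        unfolding eventually_cylinders by blast
      from * obtain z' k' where eq: "code z N = code z' k'" and z': "C i z'" by blast
      from eq have m: "map (\<lambda>i. prod_encode (z i)) [0..<N] = map (\<lambda>i. prod_encode (z' i)) [0..<k']"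
        unfolding code_def by (metis list_encode_inverse)
      then have "k' = N" by (metis length_map length_upt diff_zero)
      with m have "z' j = z j" if "j < N" for j
        using that by simp
      with N[of z'] z' show "C i z" by simp
    next
      fix k
      assume "\<forall>i. C i z"
      then show "\<exists>z' k'. code z k = code z' k' \<and> (\<forall>i. C i z')" by blast
    qed
    finally show ?thesis by (simp add: z_def[abs_def])
  qed
  then show ?thesis by blast
qed

text \<open>The Kleene-Brouwer order. Swapping the lists puts proper extensions before their
  prefixes; reversing the order of the numbers undoes the swap at the first difference, where the
  smaller entry comes first.\<close>

definition kb_less :: "nat list rel" where
  "kb_less = {(\<sigma>, \<tau>). (\<tau>, \<sigma>) \<in> lexord {(m, n). n < m}}"

lemma kb_less_linear:
  "trans kb_less" "irrefl kb_less" "total kb_less"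
proof -
  have "trans (lexord {(m, n :: nat). n < m})" by (rule lexord_transI) (auto simp: trans_def)
  then show "trans kb_less" unfolding kb_less_def trans_def by blast
  have "irrefl (lexord {(m, n :: nat). n < m})" by (rule lexord_irrefl) (auto simp: irrefl_def)
  then show "irrefl kb_less" unfolding kb_less_def irrefl_def by blast
  have "total (lexord {(m, n :: nat). n < m})" by (rule total_lexord) (auto simp: total_on_def)
  then show "total kb_less" unfolding kb_less_def total_on_def by blast
qed

text \<open>An infinite chain of one-entry extensions would have a path as its limit. The relation
  is the one for bar induction on the nodes of \<open>T\<close>.\<close>

lemma wf_tree_extension:
  assumes T: "is_tree T" and no_path: "\<And>f. \<not> is_path T f"
  shows "wf {(\<sigma> @ [n], \<sigma>) | \<sigma> n. \<sigma> @ [n] \<in> T}"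
  unfolding wf_iff_no_infinite_down_chain
proof
  assume "\<exists>s. \<forall>i. (s (Suc i), s i) \<in> {(\<sigma> @ [n], \<sigma>) | \<sigma> n. \<sigma> @ [n] \<in> T}"
  then obtain s where s: "\<And>i. \<exists>n. s (Suc i) = s i @ [n] \<and> s i @ [n] \<in> T" by blast
  have len: "length (s i) \<ge> i" for i
  proof (induction i)
    case (Suc i)
    with s[of i] show ?case by auto
  qed simp
  have mono: "prefix (s i) (s j)" if "i \<le> j" for i j
    using that
  proof (induction rule: dec_induct)
    case (step n)
    then show ?case using s[of n] by (auto intro: prefix_order.trans)
  qed simp
  \<comment> \<open>\<open>s (Suc n)\<close> has at least \<open>Suc n\<close> entries and all later
    nodes extend it, so its entry \<open>n\<close> is final.\<close>
  define f where "f n = s (Suc n) ! n" for n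
  have "map f [0..<n] = take n (s (Suc n))" for n
  proof (rule nth_equalityI)
    fix i assume "i < length (map f [0..<n])"
    then have i: "i < n" by simp
    then obtain \<rho> where "s (Suc n) = s (Suc i) @ \<rho>" using mono[of "Suc i" "Suc n"] by (auto elim: prefixE)
    then show "map f [0..<n] ! i = take n (s (Suc n)) ! i"
      using i len[of "Suc i"] by (simp add: f_def nth_append)
  qed (use len[of "Suc n" for n] in \<open>simp add: min_absorb2 Suc_leD\<close>)
  moreover have "take n (s (Suc n)) \<in> T" for n
    using T s[of n] take_is_prefix unfolding is_tree_def by metis
  ultimately show False using no_path[of f] by (simp add: is_path_def)
qed

lemma wf_kb_less:
  assumes T: "is_tree T" and no_path: "\<And>f. \<not> is_path T f"
  shows "wf (Restr kb_less T)"
proof -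
  \<comment> \<open>Bar induction on the common prefix \<sigma>. If \<open>S\<close> contains proper
    extensions of \<sigma>, those with the least next entry \<open>k\<close> precede all other
    members, including \<sigma>; so their minimum, given by the hypothesis for
    \<open>\<sigma> @ [k]\<close>, is the minimum of \<open>S\<close>.\<close>
  have min: "\<exists>m\<in>S. \<forall>\<tau>\<in>S. (\<tau>, m) \<notin> kb_less"
    if "S \<subseteq> T" "\<And>\<tau>. \<tau> \<in> S \<Longrightarrow> prefix \<sigma> \<tau>" "S \<noteq> {}" for \<sigma> S
    using wf_tree_extension[OF assms] that
  proof (induction \<sigma> arbitrary: S rule: wf_induct_rule)
    case (less \<sigma>)
    show ?case
    proof (cases "S \<subseteq> {\<sigma>}")
      case True
      with less.prems have "S = {\<sigma>}" by blast
      then show ?thesis using kb_less_linear(2) by (simp add: irrefl_def)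
    next
      case False
      then obtain \<tau> where "\<tau> \<in> S" "\<tau> \<noteq> \<sigma>" by blast
      with less.prems(2)[of \<tau>] obtain n \<rho> where "\<tau> = \<sigma> @ n # \<rho>"
        by (metis prefix_def neq_Nil_conv append_Nil2)
      with \<open>\<tau> \<in> S\<close> have "\<exists>n \<rho>. \<sigma> @ n # \<rho> \<in> S" by blast
      define k where "k = (LEAST n. \<exists>\<rho>. \<sigma> @ n # \<rho> \<in> S)"
      have k: "\<exists>\<rho>. \<sigma> @ k # \<rho> \<in> S"
        unfolding k_def by (rule LeastI_ex) fact
      have k_le: "k \<le> n" if "\<sigma> @ n # \<rho> \<in> S" for n \<rho>
        unfolding k_def using that by (intro Least_le) blast
      define S' where "S' = {\<tau> \<in> S. prefix (\<sigma> @ [k]) \<tau>}"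
      have S': "S' \<noteq> {}" "S' \<subseteq> T"
        using k less.prems(1) by (auto simp: S'_def)
      then have "\<sigma> @ [k] \<in> T"
        using T by (auto simp: S'_def is_tree_def)
      then have "\<exists>m\<in>S'. \<forall>\<tau>\<in>S'. (\<tau>, m) \<notin> kb_less"
        using S' by (intro less.IH[of "\<sigma> @ [k]"]) (auto simp: S'_def)
      then obtain m where m: "m \<in> S'" "\<And>\<tau>. \<tau> \<in> S' \<Longrightarrow> (\<tau>, m) \<notin> kb_less" by blast
      then obtain \<mu> where \<mu>: "m = \<sigma> @ k # \<mu>" by (auto simp: S'_def elim!: prefixE)
      have "(\<tau>, m) \<notin> kb_less" if "\<tau> \<in> S" for \<tau>
      proof (cases "\<tau> \<in> S'")
        case False
        from less.prems(2)[OF that] obtain \<rho> where \<rho>: "\<tau> = \<sigma> @ \<rho>" by (auto elim: prefixE)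
        show ?thesis
        proof (cases \<rho>)
          case Nil
          then show ?thesis
            using lexord_same_pref_iff[of \<sigma> "k # \<mu>" "[]" "{(m, n). n < m}"]
            by (simp add: kb_less_def \<mu> \<rho>)
        next
          case (Cons n \<rho>')
          with False that \<rho> have "n \<noteq> k" by (auto simp: S'_def)
          moreover have "k \<le> n" using k_le that \<rho> Cons by blast
          ultimately show ?thesis using Cons
            by (simp add: kb_less_def \<mu> \<rho> irrefl_def)
        qed
      qed (rule m)
      moreover have "m \<in> S" using m(1) by (simp add: S'_def)
      ultimately show ?thesis by blast
    qed
  qed
  show ?thesis
  proof (rule wfI_min)
    fix \<sigma> and Q :: "nat list set" assume "\<sigma> \<in> Q"
    show "\<exists>m\<in>Q. \<forall>\<tau>. (\<tau>, m) \<in> Restr kb_less T \<longrightarrow> \<tau> \<notin> Q"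
    proof (cases "Q \<inter> T = {}")
      case True
      with \<open>\<sigma> \<in> Q\<close> show ?thesis by blast
    next
      case False
      with min[of "Q \<inter> T" "[]"] show ?thesis by auto
    qed
  qed
qed

text \<open>
  Numbers that do not code a node of \<open>T\<close> become leaves next to \<open>T\<close>. In this way the
  universe of the Kleene-Brouwer order is always \<^term>\<open>UNIV\<close>.
\<close>

definition kb_key :: "nat list set \<Rightarrow> nat \<Rightarrow> nat list" where
  "kb_key T a = (if list_decode a \<in> T then 0 # list_decode a else [Suc a])"

definition kb_order :: "nat list set \<Rightarrow> nat rel" where
  "kb_order T = {(a, b). a = b \<or> (kb_key T a, kb_key T b) \<in> kb_less}"

lemma inj_kb_key: "inj (kb_key T)"
  by (rule injI) (auto simp: kb_key_def list_decode_eq split: if_splits)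

lemma linear_order_kb_order: "linear_order_on UNIV (kb_order T)"
  unfolding order_on_defs
proof (intro conjI)
  show "refl_on UNIV (kb_order T)" by (auto simp: kb_order_def refl_on_def)
  show "trans (kb_order T)"
    using kb_less_linear(1) unfolding kb_order_def trans_def by blast
  show "antisym (kb_order T)"
    using kb_less_linear(1,2) unfolding kb_order_def trans_def irrefl_def antisym_def by blast
  show "total_on UNIV (kb_order T)"
    using kb_less_linear(3) inj_kb_key[of T] unfolding kb_order_def total_on_def inj_def by blast
qed simp

lemma Field_kb_order: "Field (kb_order T) = UNIV"
  by (auto simp: kb_order_def Field_def)

lemma wf_kb_order:
  assumes T: "is_tree T" and no_path: "\<And>f. \<not> is_path T f"
  shows "wf (kb_order T - Id)"
proof -
  \<comment> \<open>A tree that contains all keys: the root, a copy of \<open>T\<close> behind the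
    entry 0, and a leaf \<open>[Suc a]\<close> for every \<open>a\<close>.\<close>
  define T' where "T' = {[]} \<union> (#) 0 ` T \<union> range (\<lambda>a. [Suc a])"
  have "is_tree T'"
    using T unfolding T'_def is_tree_def by (auto simp: prefix_Cons)
  moreover have "\<not> is_path T' f" for f
  proof
    assume path: "is_path T' f"
    \<comment> \<open>Length two excludes the leaves \<open>[Suc a]\<close>, so the path runs into
      the copy of \<open>T\<close>.\<close>
    then have "map f [0..<Suc (Suc 0)] \<in> T'" unfolding is_path_def by blast
    then have "f 0 = 0" by (auto simp: T'_def)
    have "map (f \<circ> Suc) [0..<n] \<in> T" for n
    proof -
      have "map f [0..<Suc n] = 0 # map (f \<circ> Suc) [0..<n]"
        using \<open>f 0 = 0\<close> by (simp add: upt_conv_Cons map_Suc_upt[symmetric] del: upt_Suc)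
      moreover have "map f [0..<Suc n] \<in> T'" using path unfolding is_path_def by blast
      ultimately show ?thesis by (auto simp: T'_def)
    qed
    with no_path[of "f \<circ> Suc"] show False by (simp add: is_path_def)
  qed
  moreover have key: "kb_key T a \<in> T'" for a
    by (simp add: T'_def kb_key_def)
  ultimately have "wf (inv_image (Restr kb_less T') (kb_key T))"
    by (intro wf_inv_image wf_kb_less)
  moreover from key have "kb_order T - Id \<subseteq> inv_image (Restr kb_less T') (kb_key T)"
    by (auto simp: kb_order_def)
  ultimately show ?thesis by (rule wf_subset)
qed

text \<open>The initial segments of \<open>f\<close> form a descending chain, since extensions come
  first.\<close>

lemma not_wf_kb_order:
  assumes "is_path T f"
  shows "\<not> wf (kb_order T - Id)"
  unfolding wf_iff_no_infinite_down_chain not_not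
proof (intro exI allI)
  fix i
  define s where "s n = list_encode (map f [0..<n])" for n
  have key: "kb_key T (s n) = 0 # map f [0..<n]" for n
    using assms by (simp add: kb_key_def s_def is_path_def)
  have "(0 # map f [0..<i], 0 # map f [0..<i] @ [f i]) \<in> lexord {(m, n). n < m}"
    by (simp add: lexord_append_rightI)
  then have less: "(kb_key T (s (Suc i)), kb_key T (s i)) \<in> kb_less"
    by (simp add: kb_less_def key)
  then have "s (Suc i) \<noteq> s i"
    using kb_less_linear(2) by (auto simp: irrefl_def)
  with less show "(list_encode (map f [0..<Suc i]), list_encode (map f [0..<i])) \<in> kb_order T - Id"
    by (simp add: kb_order_def s_def[symmetric] del: upt_Suc)
qed

text \<open>For fixed \<open>a\<close> and \<open>b\<close> the comparison asks only whether the two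
  nodes that they code belong to the tree.\<close>

lemma locally_constant_kb_order:
  assumes "\<And>\<sigma>. locally_constant (\<lambda>z. \<sigma> \<in> T z)"
  shows "locally_constant (\<lambda>z. (a, b) \<in> kb_order (T z))"
proof -
  have "locally_constant (\<lambda>z. kb_key (T z) c)" for c
    using locally_constant_comp[OF assms[of "list_decode c"],
        of "\<lambda>t. if t then 0 # list_decode c else [Suc c]"]
    by (simp add: kb_key_def)
  from locally_constant_comp2[OF this[of a] this[of b], of "\<lambda>s t. a = b \<or> (s, t) \<in> kb_less"]
  show ?thesis by (simp add: kb_order_def)
qed


section \<open>The groups \<open>\<int>\<^sup>r\<close>\<close>

abbreviation finite_support :: "(nat \<Rightarrow> int) set" where
  "finite_support \<equiv> {f. finite {x. f x \<noteq> 0}}"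

lemma fin_supp_UNIV: "Field r = UNIV \<Longrightarrow> fin_supp r = finite_support"
  by (auto simp: fin_supp_def)

lemma fin_supp_UNIV_rel: "fin_supp (UNIV :: nat rel) = finite_support"
  by (rule fin_supp_UNIV) (auto simp: Field_def)

lemma bij_from_nat_into_finite_support:
  "bij_betw (from_nat_into finite_support) UNIV finite_support"
proof (rule bij_betw_from_nat_into)
  show "countable finite_support"
    using countable_fin_supp[of UNIV] by (simp only: fin_supp_UNIV_rel)
  have "range (\<lambda>n. (\<lambda>x :: nat. if x = 0 then int n else 0)) \<subseteq> finite_support" by auto
  moreover have "inj (\<lambda>n. (\<lambda>x :: nat. if x = 0 then int n else 0))"
    by (rule injI) (auto dest: fun_cong[of _ _ 0])
  ultimately show "infinite finite_support"
    using finite_subset range_inj_infinite by blast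
qed

text \<open>One bijection is fixed for all \<open>r\<close>, so that a single entry of the name asks
  for at most one comparison in Z^r. What matters is that the name depends continuously on the
  order, hence the arbitrary enumeration.\<close>

definition decode :: "nat \<Rightarrow> nat \<Rightarrow> int" where
  "decode = from_nat_into finite_support"

definition encode :: "(nat \<Rightarrow> int) \<Rightarrow> nat" where
  "encode = inv_into UNIV decode"

lemma decode_in: "decode a \<in> finite_support"
  using bij_from_nat_into_finite_support unfolding decode_def bij_betw_def by blast

lemma encode_decode: "encode (decode a) = a"
  using bij_from_nat_into_finite_support
  unfolding encode_def decode_def bij_betw_def by (simp add: inv_into_f_f)

lemma decode_encode: "f \<in> finite_support \<Longrightarrow> decode (encode f) = f"
  using bij_from_nat_into_finite_support
  unfolding encode_def decode_def bij_betw_def by (simp add: f_inv_into_f)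

text \<open>The group is always the same; only the order depends on \<open>r\<close>.\<close>

definition group_name :: "nat rel \<Rightarrow> baire" where
  "group_name r n = (case prod_decode n of (i, k) \<Rightarrow>
    if i = 0 then 1
    else if i = 1 then (case prod_decode k of (a, b) \<Rightarrow> encode (\<lambda>x. decode a x + decode b x))
    else of_bool (case prod_decode k of (a, b) \<Rightarrow> (decode a, decode b) \<in> Z_pow r))"

lemma group_of_group_name:
  "carrier (group_of (group_name r)) = UNIV"
  "a \<otimes>\<^bsub>group_of (group_name r)\<^esub> b = encode (\<lambda>x. decode a x + decode b x)"
  by (simp_all add: group_of_def group_name_def Let_def)

lemma order_of_group_name:
  "(a, b) \<in> order_of (group_name r) \<longleftrightarrow> (decode a, decode b) \<in> Z_pow r"
  by (simp add: order_of_def group_name_def)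

lemma finite_support_add:
  "f \<in> finite_support \<Longrightarrow> g \<in> finite_support \<Longrightarrow> (\<lambda>x. f x + g x) \<in> finite_support"
  unfolding fin_supp_UNIV_rel[symmetric] by (rule fin_supp_add)

lemma decode_mult: "decode (encode (\<lambda>x. decode a x + decode b x)) = (\<lambda>x. decode a x + decode b x)"
  by (intro decode_encode finite_support_add decode_in)

lemma decode_eq_iff: "decode a = decode b \<longleftrightarrow> a = b"
  by (metis encode_decode)

lemma group_group_of_group_name: "group (group_of (group_name r))" (is "group ?G")
proof -
  define e where "e = encode (\<lambda>x. 0)"
  have e: "decode e = (\<lambda>x. 0)" unfolding e_def by (rule decode_encode) simp
  have unit: "encode (\<lambda>x. decode e x + decode a x) = a" "encode (\<lambda>x. decode a x + decode e x) = a" for a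
    by (simp_all add: e encode_decode)
  \<comment> \<open>\<open>group_of\<close> gives the neutral element by a definite description,
    which is evaluated here.\<close>
  have "(THE u. u \<in> UNIV \<and> (\<forall>x\<in>UNIV. encode (\<lambda>y. decode u y + decode x y) = x \<and>
      encode (\<lambda>y. decode x y + decode u y) = x)) = e"
    by (rule the_equality) (use unit in \<open>auto\<close>, metis unit(2))
  then have one: "\<one>\<^bsub>?G\<^esub> = e"
    by (simp add: group_of_def group_name_def Let_def)
  show ?thesis
  proof (rule groupI)
    fix a b c
    show "(a \<otimes>\<^bsub>?G\<^esub> b) \<otimes>\<^bsub>?G\<^esub> c = a \<otimes>\<^bsub>?G\<^esub> (b \<otimes>\<^bsub>?G\<^esub> c)"
      by (simp add: group_of_group_name decode_mult add.assoc)
    show "\<one>\<^bsub>?G\<^esub> \<otimes>\<^bsub>?G\<^esub> a = a"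
      by (simp add: group_of_group_name one unit)
    have "(\<lambda>x. - decode a x) \<in> finite_support" using decode_in[of a] by simp
    then have "encode (\<lambda>x. - decode a x) \<otimes>\<^bsub>?G\<^esub> a = \<one>\<^bsub>?G\<^esub>"
      by (simp add: group_of_group_name decode_encode one e_def)
    then show "\<exists>b\<in>carrier ?G. b \<otimes>\<^bsub>?G\<^esub> a = \<one>\<^bsub>?G\<^esub>"
      by (auto simp: group_of_group_name)
  qed (simp_all add: group_of_group_name)
qed

context
  fixes r :: "nat rel"
  assumes r: "Linear_order r" and F: "Field r = UNIV"
begin

lemma Field_order_of_group_name: "Field (order_of (group_name r)) = UNIV"
proof -
  have "(a, a) \<in> order_of (group_name r)" for a
    using decode_in[of a] F by (simp add: order_of_group_name Z_pow_def fin_supp_UNIV)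
  then show ?thesis by (auto intro: FieldI1)
qed

lemma order_isomorphic_group_name: "order_isomorphic (order_of (group_name r)) (Z_pow r)"
  unfolding order_isomorphic_def Field_order_of_group_name Field_Z_pow fin_supp_UNIV[OF F]
  using bij_from_nat_into_finite_support
  by (intro exI[of _ decode]) (simp add: order_of_group_name decode_def)

lemma og_rep_group_name:
  "og_rep (group_name r) = Some (group_of (group_name r), order_of (group_name r))"
proof -
  have Z: "refl_on (fin_supp r) (Z_pow r)" "trans (Z_pow r)" "antisym (Z_pow r)"
    "total_on (fin_supp r) (Z_pow r)"
    using Linear_order_Z_pow[OF r] by (simp_all add: order_on_defs Field_Z_pow)
  have in_fs: "decode a \<in> fin_supp r" for a
    using decode_in F by (simp add: fin_supp_UNIV)
  have "linear_order_on UNIV (order_of (group_name r))"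
    unfolding order_on_defs
  proof (intro conjI)
    show "refl_on UNIV (order_of (group_name r))"
      using Z(1) in_fs by (auto simp: refl_on_def order_of_group_name)
    show "trans (order_of (group_name r))"
      using Z(2) unfolding trans_def order_of_group_name by blast
    show "antisym (order_of (group_name r))"
      using Z(3) unfolding antisym_def order_of_group_name by (metis decode_eq_iff)
    show "total_on UNIV (order_of (group_name r))"
      using Z(4) in_fs unfolding total_on_def order_of_group_name by (metis decode_eq_iff)
  qed simp
  moreover have "(\<lambda>x. decode a x + decode g x, \<lambda>x. decode b x + decode g x) \<in> Z_pow r"
    "(\<lambda>x. decode g x + decode a x, \<lambda>x. decode g x + decode b x) \<in> Z_pow r"
    if "(decode a, decode b) \<in> Z_pow r" for a b g
    using Z_pow_add_right[OF that in_fs[of g]] by (simp_all add: add.commute)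
  ultimately have "ordered_group (group_of (group_name r)) (order_of (group_name r))"
    unfolding ordered_group_def
    by (simp add: group_group_of_group_name group_of_group_name order_of_group_name decode_mult)
  then show ?thesis by (simp add: og_rep_def)
qed

lemma has_type_ZQ_group_name:
  "has_type_ZQ (order_of (group_name r)) \<alpha> \<epsilon> \<longleftrightarrow> has_type_ZQ (Z_pow r) \<alpha> \<epsilon>"
  by (simp add: has_type_ZQ_def order_isomorphic_cong_left[OF order_isomorphic_group_name])

lemma group_name_in_pdom:
  "(group_of (group_name r), order_of (group_name r)) \<in> pdom OG_to_ordinal"
proof -
  from has_type_ZQ_Z_pow[OF r] obtain \<alpha> :: "nat rel" and \<epsilon> where
    \<alpha>: "\<epsilon> \<in> {0, 1}" "Well_order \<alpha>" "has_type_ZQ (Z_pow r) \<alpha> \<epsilon>" by blast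
  have "refl_on (Field \<alpha>) \<alpha>" using \<alpha>(2) by (simp add: order_on_defs)
  then have eq: "(\<alpha> - Id) \<union> Id_on (Field \<alpha>) = \<alpha>" by (auto simp: refl_on_def Id_on_def intro: FieldI1)
  then have "is_copy (Field \<alpha>, \<alpha> - Id) \<alpha>"
    using \<alpha>(2) by (auto simp: is_copy_def strict_well_order_on_def order_isomorphic_refl irrefl_def
      intro: FieldI1 FieldI2)
  moreover have "(group_of (group_name r), order_of (group_name r)) \<in> ran og_rep"
    using og_rep_group_name by (auto simp: ran_def)
  ultimately show ?thesis
    using \<alpha> by (auto simp: pdom_def OG_to_ordinal_def has_type_ZQ_group_name)
qed

end

section \<open>Comparison of r with a solution\<close>

lemma order_isomorphic_prod_singleton:
  assumes r: "Linear_order r"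
  shows "order_isomorphic r (order_prod r {(s, s)})"
proof -
  have "Field {(s, s)} = {s}" by (auto simp: Field_def)
  moreover have "Refl r" "Refl {(s, s)}" using r by (auto simp: order_on_defs refl_on_def)
  ultimately have "Field (order_prod r {(s, s)}) = Field r \<times> {s}"
    by (simp add: Field_order_prod)
  moreover have "bij_betw (\<lambda>x. (x, s)) (Field r) (Field r \<times> {s})"
    by (auto simp: bij_betw_def inj_on_def)
  ultimately show ?thesis
    unfolding order_isomorphic_def
    by (intro exI[of _ "\<lambda>x. (x, s)"]) (auto simp: order_prod_def Field_def)
qed

text \<open>With a one-point factor adjoined on the left, and for \<epsilon> = 0 also on the right,
  both cases become instances of \<open>ordLeq_of_Z_pow_iso\<close>.\<close>

lemma ordLeq_of_has_type_ZQ: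
  includes cardinal_syntax
  fixes r \<alpha> :: "nat rel"
  assumes r: "Well_order r" and \<alpha>: "Well_order \<alpha>" and type: "has_type_ZQ (Z_pow r) \<alpha> \<epsilon>"
  shows "r \<le>o \<alpha>"
proof -
  define P where "P = {(0 :: nat, 0 :: nat)}"
  have P: "Linear_order P" "Field P = {0}" "order_dense P"
    by (auto simp: P_def order_on_defs refl_on_def trans_def antisym_def total_on_def Field_def
      order_dense_def)
  have "Linear_order (Z_pow r)" "Linear_order (Z_pow \<alpha>)"
    using r \<alpha> by (simp_all add: Linear_order_Z_pow well_order_on_def)
  note sing = this[THEN order_isomorphic_prod_singleton, of "0 :: nat", folded P_def]
  note \<ZZ> = ordLeq_of_Z_pow_iso[OF r \<alpha> P(1,2)]
  show ?thesis
  proof (cases "\<epsilon> = 0")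
    case True
    with type have "order_isomorphic (Z_pow r) (Z_pow \<alpha>)" by (simp add: has_type_ZQ_def)
    from order_isomorphic_trans[OF order_isomorphic_sym[OF sing(1)] order_isomorphic_trans[OF this sing(2)]]
    have "order_isomorphic (order_prod (Z_pow r) P) (order_prod (Z_pow \<alpha>) P)" .
    then show ?thesis by (rule \<ZZ>[OF P(1,3)])
  next
    case False
    with type have "order_isomorphic (Z_pow r) (order_prod (Z_pow \<alpha>) rat_order)"
      by (simp add: has_type_ZQ_def)
    from order_isomorphic_trans[OF order_isomorphic_sym[OF sing(1)] this]
    have "order_isomorphic (order_prod (Z_pow r) P) (order_prod (Z_pow \<alpha>) rat_order)" .
    then show ?thesis by (rule \<ZZ>[OF Linear_order_rat_order order_dense_rat_order])
  qed
qed

text \<open>Of the initial-segment embedding only strict monotonicity is kept: it can be checked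
  pair by pair, and it suffices to pull well-foundedness back.\<close>

lemma embedding_into_solution:
  includes cardinal_syntax
  assumes r: "Well_order r" "Field r = UNIV"
    and sol: "(A, lt) \<in> sol OG_to_ordinal (group_of (group_name r), order_of (group_name r))"
  shows "\<exists>h. \<forall>a b. (a, b) \<in> r - Id \<longrightarrow> (h a, h b) \<in> lt"
proof -
  have lin: "Linear_order r" using r(1) by (simp add: well_order_on_def)
  from sol obtain \<alpha> :: "nat rel" and \<epsilon> where \<alpha>: "Well_order \<alpha>"
    "has_type_ZQ (order_of (group_name r)) \<alpha> \<epsilon>" "is_copy (A, lt) \<alpha>"
    by (auto simp: OG_to_ordinal_def)
  have "r \<le>o \<alpha>"
    using ordLeq_of_has_type_ZQ r(1) \<alpha>(1,2) has_type_ZQ_group_name[OF lin r(2)] by blast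
  then obtain e where e: "embed r \<alpha> e" by (auto simp: ordLeq_def)
  have inj: "inj_on e (Field r)" by (rule embed_inj_on[OF r(1) e])
  from \<alpha>(3) have "order_isomorphic \<alpha> (lt \<union> Id_on A)"
    by (auto simp: is_copy_def intro: order_isomorphic_sym)
  then obtain g where g: "bij_betw g (Field \<alpha>) (Field (lt \<union> Id_on A))"
    "\<And>x y. x \<in> Field \<alpha> \<Longrightarrow> y \<in> Field \<alpha> \<Longrightarrow> (g x, g y) \<in> lt \<union> Id_on A \<longleftrightarrow> (x, y) \<in> \<alpha>"
    by (rule order_isomorphicE) blast
  have "(g (e a), g (e b)) \<in> lt" if ab: "(a, b) \<in> r - Id" for a b
  proof -
    have "(e a, e b) \<in> \<alpha>" using embed_compat[OF e] ab by (auto simp: compat_def)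
    then have F: "e a \<in> Field \<alpha>" "e b \<in> Field \<alpha>" "(g (e a), g (e b)) \<in> lt \<union> Id_on A"
      using g(2) by (auto intro: FieldI1 FieldI2)
    have "e a \<noteq> e b" using inj ab r(2) by (auto simp: inj_on_def)
    with F g(1) have "g (e a) \<noteq> g (e b)" by (auto simp: bij_betw_def inj_on_def)
    with F(3) show ?thesis by auto
  qed
  then show ?thesis by (intro exI[of _ "g \<circ> e"]) auto
qed

text \<open>The differences of \<open>f\<close> and \<open>g\<close> form a fixed finite set, so the
  comparison is a finite Boolean combination of comparisons in \<open>R z\<close>.\<close>

lemma locally_constant_Z_pow:
  assumes R: "\<And>a b. locally_constant (\<lambda>z. (a, b) \<in> R z)" and F: "\<And>z. Field (R z) = UNIV"
    and f: "f \<in> finite_support" and g: "g \<in> finite_support"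
  shows "locally_constant (\<lambda>z. (f, g) \<in> Z_pow (R z))"
proof -
  define D where "D = {x. f x \<noteq> g x}"
  have "D \<subseteq> {x. f x \<noteq> 0} \<union> {x. g x \<noteq> 0}" by (auto simp: D_def)
  then have D: "finite D" by (rule finite_subset) (use f g in simp)
  have "locally_constant (\<lambda>z. \<forall>y\<in>D. (y, x) \<in> R z)" for x
    by (intro locally_constant_Ball D R)
  from locally_constant_comp[OF this]
  have "locally_constant (\<lambda>z. f x < g x \<and> (\<forall>y\<in>D. (y, x) \<in> R z))" for x .
  then have "locally_constant (\<lambda>z. \<exists>x\<in>D. f x < g x \<and> (\<forall>y\<in>D. (y, x) \<in> R z))"
    by (intro locally_constant_Bex D)
  from locally_constant_comp[OF this, of "(\<or>) (f = g)"] show ?thesis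
  proof (rule subst[where P = locally_constant, rotated], intro ext)
    fix z
    show "(f = g \<or> (\<exists>x\<in>D. f x < g x \<and> (\<forall>y\<in>D. (y, x) \<in> R z))) = ((f, g) \<in> Z_pow (R z))"
      using f g unfolding Z_pow_def fin_supp_UNIV[OF F] D_def by simp (metis less_irrefl)
  qed
qed

lemma locally_constant_group_name:
  assumes R: "\<And>a b. locally_constant (\<lambda>z. (a, b) \<in> R z)" and F: "\<And>z. Field (R z) = UNIV"
  shows "locally_constant (\<lambda>z. group_name (R z) n)"
proof -
  obtain i k a b where n: "prod_decode n = (i, k)" "prod_decode k = (a, b)"
    by (metis surj_pair)
  from locally_constant_comp[OF locally_constant_Z_pow[OF R F decode_in[of a] decode_in[of b]],
      of "\<lambda>t. if i = 0 then 1 else if i = 1 then encode (\<lambda>x. decode a x + decode b x) else of_bool t"]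
  show ?thesis unfolding group_name_def n prod.case .
qed

lemma is_name_closed_choice:
  "z \<in> pdom C\<^sub>N\<^sub>N \<and> is_name (in_rep C\<^sub>N\<^sub>N) p z \<longleftrightarrow>
    z = {\<sigma>. p (list_encode \<sigma>) = 1} \<and> is_tree z \<and> (\<exists>f. is_path z f)"
  by (auto simp: pdom_def closed_choice_baire_def is_name_def tree_rep_def Let_def split: if_splits)


section \<open>Irreducibility\<close>

theorem corollary2p18:
  shows "\<not> OG_to_ordinal \<le>\<^sub>W closed_choice_baire"
proof
  assume "OG_to_ordinal \<le>\<^sub>W closed_choice_baire"
  then obtain \<Phi> \<Psi> where "computable \<Phi>" "computable \<Psi>" and red:
    "\<And>p x. x \<in> pdom OG_to_ordinal \<Longrightarrow> is_name (in_rep OG_to_ordinal) p x \<Longrightarrow>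
      \<exists>p'. \<Phi> p = Some p' \<and> (\<exists>z\<in>pdom C\<^sub>N\<^sub>N. is_name (in_rep C\<^sub>N\<^sub>N) p' z \<and>
        (\<forall>q. \<forall>w\<in>sol C\<^sub>N\<^sub>N z. is_name (out_rep C\<^sub>N\<^sub>N) q w \<longrightarrow>
          (\<exists>q'. \<Psi> (baire_pair p q) = Some q' \<and>
            (\<exists>y\<in>sol OG_to_ordinal x. is_name (out_rep OG_to_ordinal) q' y))))"
    unfolding weihrauch_le_def by blast
  then obtain c d where
    c: "\<And>p q n. \<Phi> p = Some q \<Longrightarrow> oeval p c [n] (q n)" and
    d: "\<And>p q n. \<Psi> p = Some q \<Longrightarrow> oeval p d [n] (q n)"
    unfolding computable_def by blast
  define L where "L x = kb_order (diag_tree x)" for x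
  have L: "Linear_order (L x)" "Field (L x) = UNIV" for x
    using linear_order_kb_order Field_kb_order by (simp_all add: L_def)
  define nm where "nm x = group_name (L x)" for x
  \<comment> \<open>Names record membership by the value 1. In this form, that \<open>q\<close> is a
    path and that a pair lies in the output both say that certain computations halt with value
    1.\<close>
  have main: "\<exists>p'. (\<forall>n. oeval (nm x) c [n] (p' n)) \<and> (\<exists>q. \<forall>n. p' (list_encode (map q [0..<n])) = 1) \<and>
    (\<forall>q. (\<forall>n. p' (list_encode (map q [0..<n])) = 1) \<longrightarrow>
      (\<exists>q'. (\<forall>n. oeval (baire_pair (nm x) q) d [n] (q' n)) \<and>
        (\<exists>A lt. lt = {(a, b). q' (prod_encode (1, prod_encode (a, b))) = 1} \<and>
          strict_well_order_on A lt \<and>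
          (A, lt) \<in> sol OG_to_ordinal (group_of (nm x), order_of (nm x)))))" for x
  proof -
    have "is_name (in_rep OG_to_ordinal) (nm x) (group_of (nm x), order_of (nm x))"
      using og_rep_group_name[OF L] by (simp add: is_name_def OG_to_ordinal_def nm_def)
    from red[OF group_name_in_pdom[OF L, folded nm_def] this] obtain p' z where
      p': "\<Phi> (nm x) = Some p'" and z: "z \<in> pdom C\<^sub>N\<^sub>N" "is_name (in_rep C\<^sub>N\<^sub>N) p' z" and
      q: "\<And>q w. w \<in> sol C\<^sub>N\<^sub>N z \<Longrightarrow> is_name (out_rep C\<^sub>N\<^sub>N) q w \<Longrightarrow>
        \<exists>q'. \<Psi> (baire_pair (nm x) q) = Some q' \<and>
          (\<exists>y\<in>sol OG_to_ordinal (group_of (nm x), order_of (nm x)).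
            is_name (out_rep OG_to_ordinal) q' y)"
      by blast
    from z is_name_closed_choice have z_eq: "z = {\<sigma>. p' (list_encode \<sigma>) = 1}"
      and tree: "is_tree z" and path: "\<exists>f. is_path z f" by blast+
    have path_iff: "is_path z f \<longleftrightarrow> (\<forall>n. p' (list_encode (map f [0..<n])) = 1)" for f
      unfolding is_path_def z_eq by simp
    have "\<exists>q'. (\<forall>n. oeval (baire_pair (nm x) q) d [n] (q' n)) \<and>
        (\<exists>A lt. lt = {(a, b). q' (prod_encode (1, prod_encode (a, b))) = 1} \<and>
          strict_well_order_on A lt \<and>
          (A, lt) \<in> sol OG_to_ordinal (group_of (nm x), order_of (nm x)))" if "is_path z q" for q
    proof -
      from that tree have "q \<in> sol C\<^sub>N\<^sub>N z" "is_name (out_rep C\<^sub>N\<^sub>N) q q"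
        by (simp_all add: closed_choice_baire_def is_name_def)
      from q[OF this] obtain q' y where q': "\<Psi> (baire_pair (nm x) q) = Some q'"
        and y: "y \<in> sol OG_to_ordinal (group_of (nm x), order_of (nm x))"
        and "is_name (out_rep OG_to_ordinal) q' y" by blast
      then have "copy_rep q' = Some y" by (simp add: OG_to_ordinal_def is_name_def)
      then obtain A lt where "y = (A, lt)" "strict_well_order_on A lt"
        "lt = {(a, b). q' (prod_encode (1, prod_encode (a, b))) = 1}"
        by (auto simp: copy_rep_def Let_def split: if_splits)
      with y d[OF q'] show ?thesis by blast
    qed
    with c[OF p'] path show ?thesis unfolding path_iff by blast
  qed
  \<comment> \<open>A witness for \<open>x\<close> is a path \<open>Q\<close> through the tree, an embedding \<open>H\<close> of \<^term>\<open>L x\<close> into the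
    output, and bounds \<open>U\<close> on the oracle use, which make the open conditions on the computations
    clopen.\<close>
  define X where "X z = (\<lambda>i. fst (z i))" for z :: "nat \<Rightarrow> nat \<times> nat"
  define Q where "Q z = (\<lambda>i. fst (prod_decode (snd (z i))))" for z :: "nat \<Rightarrow> nat \<times> nat"
  define H where "H z i = fst (prod_decode (snd (prod_decode (snd (z i)))))"
    for z :: "nat \<Rightarrow> nat \<times> nat" and i
  define U where "U z i = snd (prod_decode (snd (prod_decode (snd (z i)))))"
    for z :: "nat \<Rightarrow> nat \<times> nat" and i
  define C where "C = (\<lambda>(n, a, b) z.
      forces (nm (X z)) (U z (prod_encode (0, n))) c [list_encode (map (Q z) [0..<n])] 1 \<and>
      ((a, b) \<in> L (X z) - Id \<longrightarrow>
        forces (baire_pair (nm (X z)) (Q z)) (U z (prod_encode (1, prod_encode (a, b)))) d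
          [prod_encode (1, prod_encode (H z a, H z b))] 1))"
  have lc_Q: "locally_constant (\<lambda>z. Q z i)" and lc_H: "locally_constant (\<lambda>z. H z i)"
    and lc_U: "locally_constant (\<lambda>z. U z i)" for i
    unfolding Q_def H_def U_def
    using locally_constant_comp[OF locally_constant_nth[of i], of "\<lambda>a. fst (prod_decode (snd a))"]
      locally_constant_comp[OF locally_constant_nth[of i],
        of "\<lambda>a. fst (prod_decode (snd (prod_decode (snd a))))"]
      locally_constant_comp[OF locally_constant_nth[of i],
        of "\<lambda>a. snd (prod_decode (snd (prod_decode (snd a))))"] by simp_all
  have lc_L: "locally_constant (\<lambda>z. (a, b) \<in> L (X z))" for a b
    unfolding L_def X_def by (rule locally_constant_kb_order) (rule locally_constant_diag_tree)
  have lc_nm: "locally_constant (\<lambda>z. nm (X z) i)" for i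
    unfolding nm_def by (rule locally_constant_group_name[OF lc_L L(2)])
  have lc_pair: "locally_constant (\<lambda>z. baire_pair (nm (X z)) (Q z) i)" for i
    using lc_nm[of "i div 2"] lc_Q[of "i div 2"] by (cases "even i") (simp_all add: baire_pair_def)
  have "locally_constant (C k)" for k
  proof -
    obtain n a b where k: "k = (n, a, b)" by (cases k)
    have "locally_constant (\<lambda>z. [list_encode (map (Q z) [0..<n])])"
      using locally_constant_comp[OF locally_constant_map[OF lc_Q], of "\<lambda>xs. [list_encode xs]"] .
    from locally_constant_forces[OF lc_U lc_nm this]
    have 1: "locally_constant (\<lambda>z. forces (nm (X z)) (U z (prod_encode (0, n))) c
        [list_encode (map (Q z) [0..<n])] 1)" .
    have "locally_constant (\<lambda>z. [prod_encode (1, prod_encode (H z a, H z b))])"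
      using locally_constant_comp2[OF lc_H[of a] lc_H[of b],
        of "\<lambda>u v. [prod_encode (1, prod_encode (u, v))]"] .
    from locally_constant_forces[OF lc_U lc_pair this]
    have 2: "locally_constant (\<lambda>z. forces (baire_pair (nm (X z)) (Q z))
        (U z (prod_encode (1, prod_encode (a, b)))) d
        [prod_encode (1, prod_encode (H z a, H z b))] 1)" .
    from locally_constant_comp2[OF 1 locally_constant_comp2[OF lc_L[of a b] 2,
        of "\<lambda>s t. s \<and> a \<noteq> b \<longrightarrow> t"], of "(\<and>)"]
    show ?thesis unfolding C_def k by simp
  qed
  \<comment> \<open>By the choice of \<open>x\<close> the paths through \<open>diag_tree x\<close>
    are the witnesses for \<open>x\<close>, while \<open>L x\<close> is a well-order iff there is no
    such path.\<close>
  from diagonal_closed[of C, OF this] obtain x where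
    x: "\<And>f. is_path (diag_tree x) f \<longleftrightarrow> (\<forall>k. C k (\<lambda>i. (x i, f i)))" by blast
  from main[of x] obtain p' where p': "\<And>n. oeval (nm x) c [n] (p' n)" and
    ex_q: "\<exists>q. \<forall>n. p' (list_encode (map q [0..<n])) = 1" and
    sol: "\<And>q. (\<forall>n. p' (list_encode (map q [0..<n])) = 1) \<Longrightarrow>
      \<exists>q'. (\<forall>n. oeval (baire_pair (nm x) q) d [n] (q' n)) \<and>
        (\<exists>A lt. lt = {(a, b). q' (prod_encode (1, prod_encode (a, b))) = 1} \<and>
          strict_well_order_on A lt \<and>
          (A, lt) \<in> sol OG_to_ordinal (group_of (nm x), order_of (nm x)))"
    by blast
  show False
  proof (cases "\<exists>f. is_path (diag_tree x) f")
    case True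
    then obtain f where f: "is_path (diag_tree x) f" by blast
    define z where "z i = (x i, f i)" for i
    have C: "C k z" for k using f x unfolding z_def[abs_def] by blast
    have X: "X z = x" by (simp add: X_def z_def)
    have "p' (list_encode (map (Q z) [0..<n])) = 1" for n
    proof -
      \<comment> \<open>The pair \<open>(0, 0)\<close> is a dummy, as is the first \<open>0\<close>
        in \<open>(0, a, b)\<close> below: each use reads one conjunct of \<open>C\<close>.\<close>
      from C[of "(n, 0, 0)"] have "oeval (nm x) c [list_encode (map (Q z) [0..<n])] 1"
        by (auto simp: C_def X dest: forces_imp_oeval)
      with p' show ?thesis by (blast intro: oeval_det)
    qed
    with sol obtain q' A lt where q': "\<And>n. oeval (baire_pair (nm x) (Q z)) d [n] (q' n)"
      and lt: "lt = {(a, b). q' (prod_encode (1, prod_encode (a, b))) = 1}"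
        "strict_well_order_on A lt" by blast
    have "(H z a, H z b) \<in> lt" if ab: "(a, b) \<in> L x - Id" for a b
    proof -
      from C[of "(0, a, b)"] ab
      have "oeval (baire_pair (nm x) (Q z)) d [prod_encode (1, prod_encode (H z a, H z b))] 1"
        by (auto simp: C_def X dest: forces_imp_oeval)
      with q' have "q' (prod_encode (1, prod_encode (H z a, H z b))) = 1" by (blast intro: oeval_det)
      then show ?thesis by (simp add: lt)
    qed
    then have "L x - Id \<subseteq> inv_image lt (H z)" unfolding inv_image_def by blast
    moreover have "wf lt"
    proof -
      have "wf (lt \<union> Id_on A - Id)" and "irrefl lt"
        using lt(2) by (simp_all add: strict_well_order_on_def well_order_on_def)
      moreover from \<open>irrefl lt\<close> have "lt \<union> Id_on A - Id = lt" by (auto simp: irrefl_def)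
      ultimately show ?thesis by simp
    qed
    ultimately have "wf (L x - Id)" by (blast intro: wf_subset wf_inv_image)
    with not_wf_kb_order[OF f] show False by (simp add: L_def)
  next
    case False
    then have "wf (L x - Id)" unfolding L_def by (intro wf_kb_order is_tree_diag_tree) auto
    with L have wo: "Well_order (L x)" by (simp add: well_order_on_def)
    from ex_q obtain q where q: "\<And>n. p' (list_encode (map q [0..<n])) = 1" by blast
    with sol obtain q' A lt where q': "\<And>n. oeval (baire_pair (nm x) q) d [n] (q' n)"
      and lt: "lt = {(a, b). q' (prod_encode (1, prod_encode (a, b))) = 1}"
      and "(A, lt) \<in> sol OG_to_ordinal (group_of (nm x), order_of (nm x))" by blast
    with embedding_into_solution[OF wo L(2)] obtain h where
      h: "\<And>a b. (a, b) \<in> L x - Id \<Longrightarrow> (h a, h b) \<in> lt" unfolding nm_def by blast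
    have "\<exists>u. forces (nm x) u c [list_encode (map q [0..<n])] 1" for n
      using oeval_imp_forces[OF p'] q by metis
    then obtain u where u: "\<And>n. forces (nm x) (u n) c [list_encode (map q [0..<n])] 1" by metis
    \<comment> \<open>Pairs outside the strict order get an arbitrary bound, as \<open>C\<close>
      asks nothing of them.\<close>
    have "\<exists>v. (a, b) \<in> L x - Id \<longrightarrow>
        forces (baire_pair (nm x) q) v d [prod_encode (1, prod_encode (h a, h b))] 1" for a b
    proof (cases "(a, b) \<in> L x - Id")
      case True
      with h have "q' (prod_encode (1, prod_encode (h a, h b))) = 1" by (auto simp: lt)
      with oeval_imp_forces[OF q'] show ?thesis by metis
    qed blast
    then obtain v where v: "\<And>a b. (a, b) \<in> L x - Id \<Longrightarrow>
        forces (baire_pair (nm x) q) (v a b) d [prod_encode (1, prod_encode (h a, h b))] 1" by metis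
    \<comment> \<open>Both families of bounds in one function; the tags 0 and 1 are those under
      which \<open>C\<close> looks them up.\<close>
    define w where "w i = (case prod_decode i of (j, k) \<Rightarrow>
      if j = 0 then u k else (case prod_decode k of (a, b) \<Rightarrow> v a b))" for i
    define f where "f i = prod_encode (q i, prod_encode (h i, w i))" for i
    define z where "z i = (x i, f i)" for i
    have z: "X z = x" "Q z = q" "H z i = h i" "U z i = w i" for i
      by (simp_all add: X_def Q_def H_def U_def z_def f_def)
    have "C k z" for k
      using u v by (auto simp: C_def z w_def split: prod.splits)
    then have "is_path (diag_tree x) f" unfolding x z_def[abs_def] by blast
    with False show False by blast
  qed
qed

end
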